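(* Consider the non-Gaussian mixed linear model described in the context, with finite fourth moments of the random effects and errors. For $0\le j,k\le s$ let $\mathcal I_{1,jk}=\operatorname{cov}\left(\frac{\partial l_{\mathrm R}}{\partial\theta_j},\frac{\partial l_{\mathrm R}}{\partial\theta_k}\right)$ be the $(j,k)$ element of $\mathcal I_1=\operatorname{Var}(\partial l_{\mathrm R}/\partial\theta)$, where the derivatives are evaluated at the true $\theta$ and the covariance is under the true distribution of $y$. Then for all $0\le j,k\le s$, $$\mathcal I_{1,jk}=2\operatorname{tr}(B_jVB_kV)+\sum_{t=0}^s\kappa_t\sum_{l=1}^{m_t}(z_{tl}'B_jz_{tl})(z_{tl}'B_kz_{tl})$$ $$=\mathrm E\left\{\sum_{f(i_1,\dots,i_4)\ne0}c_{j,k}(i_1,\dots,i_4)u_{i_1}u_{i_2}u_{i_3}u_{i_4}\right\}+\left\{2\operatorname{tr}(B_jVB_kV)-3\lambda^2\sum_{f(i_1,\dots,i_4)\neq0}c_{j,k}(i_1,\dots,i_4)\Gamma(i_1,i_3)\Gamma(i_2,i_4)\right\},$$ where $c_{j,k}(i_1,\dots,i_4)=c_{j,k,l}$ if $f(i_1,\dots,i_4)=f_l$, $1\le l\le L$, with $$c_{j,k,l}=\frac{1}{|\{(i_1,\dots,i_4):f(i_1,\dots,i_4)=f_l\}|}\sum_{f(i_1,\dots,i_4)=f_l}B_{j,i_1,i_2}B_{k,i_3,i_4}.$$ (The first expectation is denoted $\mathcal I_{1,1,jk}$ and the second braced term $\mathcal I_{1,2,jk}$, so that $\mathcal I_{1,jk}=\mathcal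 I_{1,1,jk}+\mathcal I_{1,2,jk}$.)
   Context: Model: $y=X\beta+Z_1\alpha_1+\cdots+Z_s\alpha_s+\varepsilon$, where $y$ is an $N\times1$ vector of observations, $X$ ($N\times p$, rank $p$) and $Z_t$ ($N\times m_t$, $1\le t\le s$) are known real matrices, $\beta\in\mathbb R^p$ is unknown, $\alpha_t$ is an $m_t\times1$ vector of random effects, $\varepsilon$ is an $N\times1$ vector of errors. The vectors $\alpha_1,\dots,\alpha_s,\varepsilon$ are independent; the components of $\alpha_t$ are i.i.d. with mean $0$ and variance $\sigma_t^2$, and the components of $\varepsilon$ are i.i.d. with mean $0$ and variance $\sigma_0^2>0$. No normality is assumed. Put $\alpha_0=\varepsilon$, $Z_0=I$ (the $N\times N$ identity), $m_0=N$; $\lambda=\sigma_0^2$, $\gamma_t=\sigma_t^2/\sigma_0^2$, $\gamma_0=1$; $\theta=(\theta_0,\theta_1,\dots,\theta_s)'=(\lambda,\gamma_1,\dots,\gamma_s)'$; $u=y-X\beta$ with components $u_i$. $V=\operatorname{Var}(y)=\lambda(I+\gamma_1Z_1Z_1'+\cdots+\gamma_sZ_sZ_s')$, $P=V^{-1}-V^{-1}X(X'V^{-1}X)^{-1}X'V^{-1}$. The Gaussian restricted log-likelihood is $l_{\mathrm R}(\theta)=c-\frac12\{\log|T'VT|+y'Py\}$, with $c$ a constant and $T$ any $N\times(N-p)$ matrix of rank $N-p$ with $T'X=0$. Its derivatives are $\partial l_{\mathrm R}/\partial\theta_j=u'B_ju-b_j$, where $B_0=(2\lambda)^{-1}P$,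 $B_j=(\lambda/2)PZ_jZ_j'P$ ($1\le j\le s$), $b_j=\mathrm E(u'B_ju)$. $B_{j,i_1,i_2}$ denotes the $(i_1,i_2)$ entry of $B_j$. $z_{it}'$ denotes the $i$th row of $Z_t$ and $z_{tl}$ the $l$th column of $Z_t$ (so a row is indexed $it$ with $1\le i\le N$, a column $tl$ with $1\le l\le m_t$). For vectors $a_1,\dots,a_k$ of the same dimension, $a_1\cdot a_2\cdots a_k=\sum_l a_{1l}a_{2l}\cdots a_{kl}$. $\kappa_t=\mathrm E(\alpha_{t1}^4)-3\sigma_t^4$, $0\le t\le s$ (kurtoses). $\Gamma(i_1,i_2)=\sum_{t=0}^s\gamma_t(z_{i_1t}\cdot z_{i_2t})$. For $1\le i_1,\dots,i_4\le N$, $f(i_1,\dots,i_4)=\sum_{t=0}^s\kappa_t\,z_{i_1t}\cdot z_{i_2t}\cdot z_{i_3t}\cdot z_{i_4t}$ is regarded as a (linear) function of $\kappa=(\kappa_0,\dots,\kappa_s)$, i.e. it is identified with its coefficient vector $(z_{i_1t}\cdot z_{i_2t}\cdot z_{i_3t}\cdot z_{i_4t})_{0\le t\le s}$; equalities such as $f(i_1,\dots,i_4)=f_l$ or $\ne0$ are between functions of $\kappa$. $f_1,\dots,f_L$ are the distinct nonzero functions arising in this way. Sums over conditions on $(i_1,\dots,i_4)$ range over all 4-tuples in $\{1,\dots,N\}^4$ satisfying the condition; $|\cdot|$ of a set is cardinality. *)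

theory Defs
  imports
    "HOL-Probability.Probability"
    "Jordan_Normal_Form.Gauss_Jordan_Elimination"
    "Jordan_Normal_Form.Determinant"
    "Jordan_Normal_Form.DL_Rank"
begin

(* The numbers of columns of the matrices Z t vary with t, so matrices with explicit
   dimensions are used. The clashing notation and names of HOL-Analysis are removed. *)

unbundle no vec_syntax
unbundle no inner_syntax
hide_const (open) Finite_Cartesian_Product.vec Finite_Cartesian_Product.mat
  Finite_Cartesian_Product.row Determinants.det

(* All indices are 0-based, except for t: t = 0 stands for the errors
   (Z 0 = I, m 0 = N, \<alpha> 0 = \<epsilon>), and t = 1, ..., s for the random effects. The random
   variable \<alpha> t l is the component l < m t of the random vector \<alpha> t. *)

definition mat_trace :: "real mat \<Rightarrow> real" where
  "mat_trace A = (\<Sum>i<dim_row A. A $$ (i, i))"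

(* The inverse of an invertible matrix; unspecified for a singular one. *)
definition mat_inv :: "real mat \<Rightarrow> real mat" where
  "mat_inv A = the (mat_inverse A)"

definition covariance :: "'a measure \<Rightarrow> ('a \<Rightarrow> real) \<Rightarrow> ('a \<Rightarrow> real) \<Rightarrow> real" where
  "covariance M S T = prob_space.expectation M
     (\<lambda>\<omega>. (S \<omega> - prob_space.expectation M S) * (T \<omega> - prob_space.expectation M T))"

definition response ::
  "nat \<Rightarrow> nat \<Rightarrow> (nat \<Rightarrow> nat) \<Rightarrow> real mat \<Rightarrow> (nat \<Rightarrow> real mat) \<Rightarrow> real vec \<Rightarrow>
   (nat \<Rightarrow> nat \<Rightarrow> 'a \<Rightarrow> real) \<Rightarrow> 'a \<Rightarrow> real vec" where
  "response N s m X Z \<beta> \<alpha> \<omega> =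
     vec N (\<lambda>i. (X *\<^sub>v \<beta>) $ i + (\<Sum>t=1..s. (Z t *\<^sub>v vec (m t) (\<lambda>l. \<alpha> t l \<omega>)) $ i) + \<alpha> 0 i \<omega>)"

(* Here \<theta> 0 is \<lambda>, and \<theta> t is \<gamma>_t for t = 1, ..., s. *)
definition var_mat :: "nat \<Rightarrow> nat \<Rightarrow> (nat \<Rightarrow> real mat) \<Rightarrow> (nat \<Rightarrow> real) \<Rightarrow> real mat" where
  "var_mat N s Z \<theta> = mat N N (\<lambda>(i, i').
     \<theta> 0 * (1\<^sub>m N $$ (i, i') + (\<Sum>t=1..s. \<theta> t * (Z t * (Z t)\<^sup>T) $$ (i, i'))))"

definition P_mat :: "nat \<Rightarrow> nat \<Rightarrow> real mat \<Rightarrow> (nat \<Rightarrow> real mat) \<Rightarrow> (nat \<Rightarrow> real) \<Rightarrow> real mat" where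
  "P_mat N s X Z \<theta> =
     (let W = mat_inv (var_mat N s Z \<theta>)
      in W - W * X * mat_inv (X\<^sup>T * W * X) * X\<^sup>T * W)"

definition B_mat ::
  "nat \<Rightarrow> nat \<Rightarrow> real mat \<Rightarrow> (nat \<Rightarrow> real mat) \<Rightarrow> (nat \<Rightarrow> real) \<Rightarrow> nat \<Rightarrow> real mat" where
  "B_mat N s X Z \<theta> j =
     (if j = 0 then (1 / (2 * \<theta> 0)) \<cdot>\<^sub>m P_mat N s X Z \<theta>
      else (\<theta> 0 / 2) \<cdot>\<^sub>m (P_mat N s X Z \<theta> * Z j * (Z j)\<^sup>T * P_mat N s X Z \<theta>))"

definition restricted_loglik ::
  "real \<Rightarrow> real mat \<Rightarrow> nat \<Rightarrow> nat \<Rightarrow> real mat \<Rightarrow> (nat \<Rightarrow> real mat) \<Rightarrow> real vec \<Rightarrow> (nat \<Rightarrow> real) \<Rightarrow> real"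
where
  "restricted_loglik c T N s X Z y \<theta> =
     c - 1/2 * (ln (det (T\<^sup>T * var_mat N s Z \<theta> * T)) + y \<bullet> (P_mat N s X Z \<theta> *\<^sub>v y))"

definition partial_deriv :: "nat \<Rightarrow> ((nat \<Rightarrow> real) \<Rightarrow> real) \<Rightarrow> (nat \<Rightarrow> real) \<Rightarrow> real" where
  "partial_deriv j g \<theta> = deriv (\<lambda>x. g (\<theta>(j := x))) (\<theta> j)"

definition Gam :: "nat \<Rightarrow> (nat \<Rightarrow> real mat) \<Rightarrow> (nat \<Rightarrow> real) \<Rightarrow> nat \<Rightarrow> nat \<Rightarrow> real" where
  "Gam s Z \<gamma> i1 i2 = (\<Sum>t\<le>s. \<gamma> t * (row (Z t) i1 \<bullet> row (Z t) i2))"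

definition kurtosis ::
  "'a measure \<Rightarrow> (nat \<Rightarrow> nat \<Rightarrow> 'a \<Rightarrow> real) \<Rightarrow> (nat \<Rightarrow> real) \<Rightarrow> nat \<Rightarrow> real" where
  "kurtosis M \<alpha> \<sigma> t = prob_space.expectation M (\<lambda>\<omega>. \<alpha> t 0 \<omega> ^ 4) - 3 * \<sigma> t ^ 4"

definition quads :: "nat \<Rightarrow> (nat \<times> nat \<times> nat \<times> nat) set" where
  "quads N = {..<N} \<times> {..<N} \<times> {..<N} \<times> {..<N}"

(* The last argument is a function argument, not a parameter: f_fun s m Z i is the linear function
   of the vector (\<kappa> 0, ..., \<kappa> s), and equations between values of f_fun s m Z are
   equations between such functions. *)
definition f_fun ::
  "nat \<Rightarrow> (nat \<Rightarrow> nat) \<Rightarrow> (nat \<Rightarrow> real mat) \<Rightarrow> nat \<times> nat \<times> nat \<times> nat \<Rightarrow> ((nat \<Rightarrow> real) \<Rightarrow> real)" where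
  "f_fun s m Z = (\<lambda>(i1, i2, i3, i4). \<lambda>\<kappa>. \<Sum>t\<le>s. \<kappa> t *
     (\<Sum>l<m t. Z t $$ (i1, l) * Z t $$ (i2, l) * Z t $$ (i3, l) * Z t $$ (i4, l)))"

(* The coefficient c_{j,k,l} belonging to the value g = f_l of f, for A = B_j and B = B_k. *)
definition c_val ::
  "nat \<Rightarrow> (nat \<times> nat \<times> nat \<times> nat \<Rightarrow> ((nat \<Rightarrow> real) \<Rightarrow> real)) \<Rightarrow> real mat \<Rightarrow> real mat \<Rightarrow>
   ((nat \<Rightarrow> real) \<Rightarrow> real) \<Rightarrow> real" where
  "c_val N f A B g =
     1 / real (card {i \<in> quads N. f i = g}) *
     (\<Sum>(i1, i2, i3, i4) \<in> {i \<in> quads N. f i = g}. A $$ (i1, i2) * B $$ (i3, i4))"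

definition c_coef ::
  "nat \<Rightarrow> (nat \<times> nat \<times> nat \<times> nat \<Rightarrow> ((nat \<Rightarrow> real) \<Rightarrow> real)) \<Rightarrow> real mat \<Rightarrow> real mat \<Rightarrow>
   nat \<times> nat \<times> nat \<times> nat \<Rightarrow> real" where
  "c_coef N f A B i = c_val N f A B (f i)"

end

theory Submission
  imports Defs
begin

text \<open>
  The matrix \<open>V\<close> is affine in each single component of \<open>\<theta>\<close>, say with slope \<open>D\<close>, and the
  projection \<open>P\<close> satisfies the resolvent identity \<open>P - Q = h (P D Q)\<close>, where \<open>Q\<close> belongs to
  \<open>V + h D\<close>. Together with continuity of matrix inversion this gives
  \<open>\<partial>(y' P y) = - y' P D P y = - 2 y' B\<^sub>j y\<close>, and \<open>B\<^sub>j X = 0\<close> replaces \<open>y\<close> by \<open>u\<close>. The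
  log-determinant only contributes a constant, so each score is a constant plus a quadratic form
  in \<open>u\<close>.

  All components of all random effects form one independent family, and
  \<open>u\<close> is linear in it. Hence \<open>E(u\<^sub>1 u\<^sub>2 u\<^sub>3 u\<^sub>4)\<close> is the Gaussian sum over the three
  pairings plus \<open>f(i\<^sub>1, \<dots>, i\<^sub>4)\<close> evaluated at \<open>\<kappa>\<close>; the pairing that matches the
  two quadratic forms separately cancels in the covariance and the other two give the trace.

  For the second formula, averaging the coefficients over the level sets of \<open>f\<close> does not change
  their sum against \<open>f\<close>, and as \<open>f\<close> is symmetric in its four indices, so is \<open>c\<close>; therefore the three
  pairings contribute equally, which is the factor \<open>3 \<lambda>\<^sup>2\<close>.
\<close>

section \<open>Limits and inverses of matrices\<close>

text \<open>The dimensions are required only eventually: \<open>mat_inv\<close> is unspecified at a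
  singular argument, so a family of inverses is known to lie in the right carrier only near its
  limit.\<close>

definition mat_tendsto ::
  "nat \<Rightarrow> nat \<Rightarrow> ('b \<Rightarrow> real mat) \<Rightarrow> real mat \<Rightarrow> 'b filter \<Rightarrow> bool" where
  "mat_tendsto n m A L F \<longleftrightarrow> eventually (\<lambda>x. A x \<in> carrier_mat n m) F \<and> L \<in> carrier_mat n m \<and>
     (\<forall>i<n. \<forall>j<m. ((\<lambda>x. A x $$ (i, j)) \<longlongrightarrow> L $$ (i, j)) F)"

text \<open>The entries may be replaced by explicit formulas \<open>g\<close> that are valid only
  near the limit. This suits inverses, whose formula by minors needs a nonzero determinant.\<close>

lemma mat_tendstoI:
  assumes "eventually (\<lambda>x. A x \<in> carrier_mat n m \<and> (\<forall>i<n. \<forall>j<m. A x $$ (i, j) = g i j x)) F"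
    and "L \<in> carrier_mat n m"
    and "\<And>i j. i < n \<Longrightarrow> j < m \<Longrightarrow> (g i j \<longlongrightarrow> L $$ (i, j)) F"
  shows "mat_tendsto n m A L F"
  unfolding mat_tendsto_def
proof (intro conjI allI impI)
  show "\<forall>\<^sub>F x in F. A x \<in> carrier_mat n m"
    using assms(1) by (rule eventually_mono) simp
next
  fix i j assume ij: "i < n" "j < m"
  have "\<forall>\<^sub>F x in F. g i j x = A x $$ (i, j)"
    using assms(1) by (rule eventually_mono) (use ij in auto)
  then show "((\<lambda>x. A x $$ (i, j)) \<longlongrightarrow> L $$ (i, j)) F"
    using assms(3)[OF ij] by (rule Lim_transform_eventually[rotated])
qed (rule assms(2))

lemma mat_tendsto_const: "A \<in> carrier_mat n m \<Longrightarrow> mat_tendsto n m (\<lambda>_. A) A F"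
  by (simp add: mat_tendsto_def)

lemma mat_tendsto_minus:
  assumes "mat_tendsto n m A K F" "mat_tendsto n m B L F"
  shows "mat_tendsto n m (\<lambda>x. A x - B x) (K - L) F"
proof (rule mat_tendstoI[where g = "\<lambda>i j x. A x $$ (i, j) - B x $$ (i, j)"])
  have "\<forall>\<^sub>F x in F. A x \<in> carrier_mat n m" "\<forall>\<^sub>F x in F. B x \<in> carrier_mat n m"
    using assms by (auto simp: mat_tendsto_def)
  then show "\<forall>\<^sub>F x in F. A x - B x \<in> carrier_mat n m \<and>
      (\<forall>i<n. \<forall>j<m. (A x - B x) $$ (i, j) = A x $$ (i, j) - B x $$ (i, j))"
    by eventually_elim auto
qed (use assms in \<open>auto simp: mat_tendsto_def intro!: tendsto_diff\<close>)

lemma mat_tendsto_mult: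
  assumes "mat_tendsto n l A K F" "mat_tendsto l m B L F"
  shows "mat_tendsto n m (\<lambda>x. A x * B x) (K * L) F"
proof (rule mat_tendstoI[where g = "\<lambda>i j x. \<Sum>k\<in>{0..<l}. A x $$ (i, k) * B x $$ (k, j)"])
  have "\<forall>\<^sub>F x in F. A x \<in> carrier_mat n l" "\<forall>\<^sub>F x in F. B x \<in> carrier_mat l m"
    using assms by (auto simp: mat_tendsto_def)
  then show "\<forall>\<^sub>F x in F. A x * B x \<in> carrier_mat n m \<and>
      (\<forall>i<n. \<forall>j<m. (A x * B x) $$ (i, j) = (\<Sum>k\<in>{0..<l}. A x $$ (i, k) * B x $$ (k, j)))"
    by eventually_elim (auto simp: scalar_prod_def)
next
  show "K * L \<in> carrier_mat n m"
    using assms by (auto simp: mat_tendsto_def)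
next
  fix i j assume ij: "i < n" "j < m"
  have "K \<in> carrier_mat n l" "L \<in> carrier_mat l m"
    using assms by (auto simp: mat_tendsto_def)
  then have "(K * L) $$ (i, j) = (\<Sum>k\<in>{0..<l}. K $$ (i, k) * L $$ (k, j))"
    using ij by (auto simp: scalar_prod_def)
  then show "((\<lambda>x. \<Sum>k\<in>{0..<l}. A x $$ (i, k) * B x $$ (k, j)) \<longlongrightarrow> (K * L) $$ (i, j)) F"
    using assms ij by (auto simp: mat_tendsto_def intro!: tendsto_sum tendsto_mult)
qed

text \<open>By the Leibniz formula the determinant is a polynomial in the entries.\<close>

lemma tendsto_det:
  assumes "mat_tendsto n n A L F"
  shows "((\<lambda>x. det (A x)) \<longlongrightarrow> det L) F"
proof -
  have ev: "\<forall>\<^sub>F x in F. A x \<in> carrier_mat n n" and L: "L \<in> carrier_mat n n"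
    using assms by (auto simp: mat_tendsto_def)
  have "((\<lambda>x. \<Sum>p | p permutes {0..<n}. signof p * (\<Prod>i = 0..<n. A x $$ (i, p i))) \<longlongrightarrow> det L) F"
    unfolding det_def'[OF L]
    using assms
    by (intro tendsto_sum tendsto_mult tendsto_const tendsto_prod)
       (auto simp: mat_tendsto_def permutes_def)
  then show ?thesis
    by (rule Lim_transform_eventually) (use ev in \<open>eventually_elim, simp add: det_def'\<close>)
qed

lemma mat_tendsto_delete:
  assumes "mat_tendsto n n A L F" "i < n" "j < n"
  shows "mat_tendsto (n - 1) (n - 1) (\<lambda>x. mat_delete (A x) i j) (mat_delete L i j) F"
proof (rule mat_tendstoI[where
      g = "\<lambda>i' j' x. A x $$ (if i' < i then i' else Suc i', if j' < j then j' else Suc j')"])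
  have "\<forall>\<^sub>F x in F. A x \<in> carrier_mat n n"
    using assms by (auto simp: mat_tendsto_def)
  then show "\<forall>\<^sub>F x in F. mat_delete (A x) i j \<in> carrier_mat (n - 1) (n - 1) \<and>
      (\<forall>i'<n - 1. \<forall>j'<n - 1. mat_delete (A x) i j $$ (i', j') =
         A x $$ (if i' < i then i' else Suc i', if j' < j then j' else Suc j'))"
    by eventually_elim (auto simp: mat_delete_def)
  have L: "L \<in> carrier_mat n n"
    using assms by (auto simp: mat_tendsto_def)
  then show "mat_delete L i j \<in> carrier_mat (n - 1) (n - 1)"
    by (auto simp: mat_delete_def)
  fix i' j' assume "i' < n - 1" "j' < n - 1"
  then show "((\<lambda>x. A x $$ (if i' < i then i' else Suc i', if j' < j then j' else Suc j'))
      \<longlongrightarrow> mat_delete L i j $$ (i', j')) F"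
    using assms L by (auto simp: mat_tendsto_def mat_delete_def)
qed

lemma mat_inv_props:
  assumes A: "A \<in> carrier_mat n n" and "det A \<noteq> 0"
  shows "mat_inv A \<in> carrier_mat n n" "A * mat_inv A = 1\<^sub>m n" "mat_inv A * A = 1\<^sub>m n"
proof -
  obtain B where "mat_inverse A = Some B"
    using mat_inverse(1)[OF A, of "()"] det_non_zero_imp_unit[OF assms, of "()"]
    by (cases "mat_inverse A") auto
  with mat_inverse(2)[OF A this]
  show "mat_inv A \<in> carrier_mat n n" "A * mat_inv A = 1\<^sub>m n" "mat_inv A * A = 1\<^sub>m n"
    by (auto simp: mat_inv_def)
qed

text \<open>Cramer's rule, read off from \<open>det A\<close> times the inverse being the adjugate:
  multiply \<open>A * adj_mat A\<close> by the inverse from the left.\<close>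

lemma mat_inv_entry:
  assumes A: "A \<in> carrier_mat n n" and d: "det A \<noteq> 0" and ij: "i < n" "j < n"
  shows "mat_inv A $$ (i, j) = (-1) ^ (j + i) * det (mat_delete A j i) / det A"
proof -
  note W = mat_inv_props[OF A d]
  note adj = adj_mat[OF A]
  have "det A \<cdot>\<^sub>m mat_inv A = mat_inv A * (A * adj_mat A)"
    using W(1) by (simp add: adj(2) mult_smult_distrib[OF W(1) one_carrier_mat])
  also have "\<dots> = adj_mat A"
    using W adj(1) A by (simp flip: assoc_mult_mat[OF W(1) A adj(1)])
  finally have "(det A \<cdot>\<^sub>m mat_inv A) $$ (i, j) = adj_mat A $$ (i, j)"
    by simp
  then have "det A * mat_inv A $$ (i, j) = (-1) ^ (j + i) * det (mat_delete A j i)"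
    using W(1) ij A by (auto simp: adj_mat_def cofactor_def)
  then show ?thesis
    using d by (simp add: field_simps)
qed

lemma eventually_det_nonzero:
  assumes "mat_tendsto n n A L F" "det L \<noteq> 0"
  shows "\<forall>\<^sub>F x in F. A x \<in> carrier_mat n n \<and> det (A x) \<noteq> 0"
proof -
  have "\<forall>\<^sub>F x in F. A x \<in> carrier_mat n n"
    using assms(1) by (auto simp: mat_tendsto_def)
  moreover have "\<forall>\<^sub>F x in F. det (A x) \<noteq> 0"
    using tendsto_det[OF assms(1)] assms(2) by (rule tendsto_imp_eventually_ne)
  ultimately show ?thesis
    by eventually_elim simp
qed

text \<open>Cramer's rule writes each entry of the inverse as a quotient of determinants, which are
  continuous, and the denominator stays nonzero near the limit.\<close>

lemma mat_tendsto_inv: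
  assumes "mat_tendsto n n A L F" "det L \<noteq> 0"
  shows "mat_tendsto n n (\<lambda>x. mat_inv (A x)) (mat_inv L) F"
proof (rule mat_tendstoI[where g = "\<lambda>i j x. (-1) ^ (j + i) * det (mat_delete (A x) j i) / det (A x)"])
  have L: "L \<in> carrier_mat n n"
    using assms by (auto simp: mat_tendsto_def)
  show "\<forall>\<^sub>F x in F. mat_inv (A x) \<in> carrier_mat n n \<and> (\<forall>i<n. \<forall>j<n.
      mat_inv (A x) $$ (i, j) = (-1) ^ (j + i) * det (mat_delete (A x) j i) / det (A x))"
    using eventually_det_nonzero[OF assms]
    by eventually_elim (auto simp: mat_inv_props mat_inv_entry)
  show "mat_inv L \<in> carrier_mat n n"
    using L assms(2) by (rule mat_inv_props)
  fix i j assume ij: "i < n" "j < n"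
  show "((\<lambda>x. (-1) ^ (j + i) * det (mat_delete (A x) j i) / det (A x)) \<longlongrightarrow> mat_inv L $$ (i, j)) F"
    unfolding mat_inv_entry[OF L assms(2) ij]
    using assms ij
    by (intro tendsto_divide tendsto_mult tendsto_const tendsto_det[OF mat_tendsto_delete] tendsto_det)
qed

lemma quad_form_sum:
  fixes A :: "real mat"
  assumes "A \<in> carrier_mat n n" "y \<in> carrier_vec n"
  shows "y \<bullet> (A *\<^sub>v y) = (\<Sum>i<n. \<Sum>j<n. A $$ (i, j) * (y $ i * y $ j))"
  using assms
  by (auto simp: scalar_prod_def sum_distrib_left lessThan_atLeast0 mult_ac intro!: sum.cong)

lemma tendsto_quad_form:
  assumes "mat_tendsto n n A L F" "y \<in> carrier_vec n"
  shows "((\<lambda>x. y \<bullet> (A x *\<^sub>v y)) \<longlongrightarrow> y \<bullet> (L *\<^sub>v y)) F"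
proof -
  have ev: "\<forall>\<^sub>F x in F. A x \<in> carrier_mat n n" and L: "L \<in> carrier_mat n n"
    using assms by (auto simp: mat_tendsto_def)
  have "((\<lambda>x. \<Sum>i<n. \<Sum>j<n. A x $$ (i, j) * (y $ i * y $ j)) \<longlongrightarrow> y \<bullet> (L *\<^sub>v y)) F"
    unfolding quad_form_sum[OF L assms(2)]
    using assms by (auto simp: mat_tendsto_def intro!: tendsto_sum tendsto_mult)
  then show ?thesis
    by (rule Lim_transform_eventually)
       (use ev in \<open>eventually_elim, simp add: quad_form_sum[OF _ assms(2)]\<close>)
qed

text \<open>The Leibniz expansion is a polynomial in x. Only the existence of the derivative is
  recorded, since its value disappears from the covariance of the scores.\<close>

lemma field_differentiable_det_affine:
  assumes "A \<in> carrier_mat n n" "D \<in> carrier_mat n n"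
  shows "(\<lambda>x. det (A + (x - a) \<cdot>\<^sub>m D)) field_differentiable (at x0)"
proof -
  have "det (A + (x - a) \<cdot>\<^sub>m D) =
      (\<Sum>p | p permutes {0..<n}. signof p * (\<Prod>i = 0..<n. A $$ (i, p i) + (x - a) * D $$ (i, p i)))" for x
    by (subst det_def'[of _ n])
       (use assms in \<open>auto intro!: sum.cong prod.cong simp: permutes_def\<close>)
  moreover have "(\<lambda>x. \<Sum>p | p permutes {0..<n}. signof p *
      (\<Prod>i = 0..<n. A $$ (i, p i) + (x - a) * D $$ (i, p i))) field_differentiable (at x0)"
  proof (intro field_differentiable_sum field_differentiable_mult field_differentiable_const)
    fix p
    show "(\<lambda>x. \<Prod>i = 0..<n. A $$ (i, p i) + (x - a) * D $$ (i, p i)) field_differentiable (at x0)"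
      unfolding field_differentiable_def
      by (rule exI, rule has_field_derivative_prod) (auto intro!: derivative_eq_intros)
  qed
  ultimately show ?thesis
    by simp
qed

section \<open>Positive definiteness, symmetry of inverses, and full column rank\<close>

definition pos_def_mat :: "nat \<Rightarrow> real mat \<Rightarrow> bool" where
  "pos_def_mat n A \<longleftrightarrow> A \<in> carrier_mat n n \<and> (\<forall>v\<in>carrier_vec n. v \<noteq> 0\<^sub>v n \<longrightarrow> v \<bullet> (A *\<^sub>v v) > 0)"

text \<open>A nonzero vector in the kernel would make the quadratic form vanish.\<close>

lemma pos_def_mat_det:
  assumes "pos_def_mat n A"
  shows "det A \<noteq> 0"
proof
  assume "det A = 0"
  moreover have A: "A \<in> carrier_mat n n"
    using assms by (simp add: pos_def_mat_def)
  ultimately obtain v where v: "v \<in> carrier_vec n" "v \<noteq> 0\<^sub>v n" "A *\<^sub>v v = 0\<^sub>v n"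
    using det_0_iff_vec_prod_zero_field by blast
  then have "v \<bullet> (A *\<^sub>v v) = 0"
    by simp
  with assms v show False
    by (auto simp: pos_def_mat_def)
qed

lemma scalar_prod_mult_transpose:
  fixes A :: "real mat"
  assumes "A \<in> carrier_mat n m" "v \<in> carrier_vec m" "w \<in> carrier_vec n"
  shows "v \<bullet> (A\<^sup>T *\<^sub>v w) = (A *\<^sub>v v) \<bullet> w"
  using assms by (metis transpose_vec_mult_scalar transpose_carrier_mat mult_mat_vec_carrier comm_scalar_prod)

text \<open>The quadratic form of \<open>C\<^sup>T * A * C\<close> at v is that of A at Cv, and Cv
  is nonzero by injectivity. This serves three times: for the inverse of V, for the Gram matrix of X
  weighted by that inverse, and for \<open>T\<^sup>T * V * T\<close>.\<close>

lemma pos_def_mat_congruence: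
  assumes "pos_def_mat n A" and C: "C \<in> carrier_mat n m"
    and "\<And>v. v \<in> carrier_vec m \<Longrightarrow> C *\<^sub>v v = 0\<^sub>v n \<Longrightarrow> v = 0\<^sub>v m"
  shows "pos_def_mat m (C\<^sup>T * A * C)"
  unfolding pos_def_mat_def
proof (intro conjI ballI impI)
  have A: "A \<in> carrier_mat n n"
    using assms by (simp add: pos_def_mat_def)
  show "C\<^sup>T * A * C \<in> carrier_mat m m"
    using A C by simp
  fix v :: "real vec" assume v: "v \<in> carrier_vec m" "v \<noteq> 0\<^sub>v m"
  have Cv: "C *\<^sub>v v \<in> carrier_vec n"
    using C v by simp
  have "(C\<^sup>T * A * C) *\<^sub>v v = C\<^sup>T *\<^sub>v (A *\<^sub>v (C *\<^sub>v v))"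
    using A C v by (simp add: assoc_mult_mat_vec[of _ m n] assoc_mult_mat_vec[of _ m n _ m])
  then have "v \<bullet> ((C\<^sup>T * A * C) *\<^sub>v v) = (C *\<^sub>v v) \<bullet> (A *\<^sub>v (C *\<^sub>v v))"
    using scalar_prod_mult_transpose[OF C v(1)] A Cv by simp
  also have "C *\<^sub>v v \<noteq> 0\<^sub>v n"
    using assms(3) v by blast
  then have "(C *\<^sub>v v) \<bullet> (A *\<^sub>v (C *\<^sub>v v)) > 0"
    using assms(1) Cv by (simp add: pos_def_mat_def)
  finally show "v \<bullet> ((C\<^sup>T * A * C) *\<^sub>v v) > 0" .
qed

text \<open>The transposed inverse is a left inverse of the symmetric A, and a left inverse
  coincides with the two-sided one.\<close>

lemma mat_inv_transpose:
  assumes A: "A \<in> carrier_mat n n" and "det A \<noteq> 0" and sym: "A\<^sup>T = A"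
  shows "(mat_inv A)\<^sup>T = mat_inv A"
proof -
  note W = mat_inv_props[OF A assms(2)]
  have "(A * mat_inv A)\<^sup>T = (mat_inv A)\<^sup>T * A"
    using transpose_mult[OF A W(1)] sym by simp
  then have eq: "(mat_inv A)\<^sup>T * A = 1\<^sub>m n"
    by (simp add: W(2))
  have "(mat_inv A)\<^sup>T = (mat_inv A)\<^sup>T * (A * mat_inv A)"
    using W by simp
  also have "\<dots> = (mat_inv A)\<^sup>T * A * mat_inv A"
    using W A by (simp add: assoc_mult_mat[of _ n n _ n _ n])
  also have "\<dots> = mat_inv A"
    using W eq by simp
  finally show ?thesis .
qed

text \<open>For symmetric A the inverse W equals \<open>W\<^sup>T * A * W\<close>, a congruence by
  an injective matrix.\<close>

lemma pos_def_mat_inv: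
  assumes "pos_def_mat n A" and sym: "A\<^sup>T = A"
  shows "pos_def_mat n (mat_inv A)"
proof -
  have A: "A \<in> carrier_mat n n"
    using assms by (simp add: pos_def_mat_def)
  have d: "det A \<noteq> 0"
    using assms by (simp add: pos_def_mat_det)
  note W = mat_inv_props[OF A d]
  have "pos_def_mat n ((mat_inv A)\<^sup>T * A * mat_inv A)"
  proof (rule pos_def_mat_congruence[OF assms(1) W(1)])
    fix v :: "real vec" assume v: "v \<in> carrier_vec n" "mat_inv A *\<^sub>v v = 0\<^sub>v n"
    have "A *\<^sub>v (mat_inv A *\<^sub>v v) = v"
      using assoc_mult_mat_vec[OF A W(1) v(1)] W(2) v(1) by simp
    moreover have "A *\<^sub>v 0\<^sub>v n = 0\<^sub>v n"
      using A by (intro eq_vecI) auto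
    ultimately show "v = 0\<^sub>v n"
      using v A by simp
  qed
  then show ?thesis
    using W by (simp add: mat_inv_transpose[OF A d sym])
qed

lemma full_column_rank_injective:
  fixes A :: "real mat"
  assumes A: "A \<in> carrier_mat n m" and rank: "vec_space.rank n A = m"
    and v: "v \<in> carrier_vec m" "A *\<^sub>v v = 0\<^sub>v n"
  shows "v = 0\<^sub>v m"
proof (rule ccontr)
  assume "v \<noteq> 0\<^sub>v m"
  interpret vec_space "TYPE(real)" n .
  \<comment> \<open>\<open>lin_indpt\<close> speaks about the set of columns, so repeated columns
    have to be excluded first. A maximal independent set S of columns has m elements, and there are
    only m columns in the list, hence they are distinct; only then does a nonzero kernel vector give
    a dependence.\<close>
  obtain S where S: "maximal S (\<lambda>T. T \<subseteq> set (cols A) \<and> lin_indpt T)"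
    using maximal_exists[of "(\<lambda>T. T \<subseteq> set (cols A) \<and> lin_indpt T)" "card (set (cols A))" "{}"]
    by (meson List.finite_set card_mono empty_iff empty_subsetI finite_lin_indpt2 rev_finite_subset)
  then have "card S \<le> card (set (cols A))"
    by (simp add: card_mono maximal_def)
  moreover have "card S = m"
    using rank_card_indpt[OF A S] rank by simp
  moreover have "length (cols A) = m"
    using A by simp
  ultimately have "distinct (cols A)"
    by (metis card_distinct card_length le_antisym)
  moreover from this have "lin_indpt (set (cols A))"
    using full_rank_lin_indpt[OF A] rank by blast
  ultimately show False
    using lin_depI[OF A v(1) \<open>v \<noteq> 0\<^sub>v m\<close> v(2)] by blast
qed

section \<open>The projection and its derivative\<close>

text \<open>The matrix P as a function of an arbitrary V, so that V can be perturbed along a matrix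
  direction without reference to \<theta>.\<close>

definition gls_proj :: "real mat \<Rightarrow> real mat \<Rightarrow> real mat" where
  "gls_proj X V = (let W = mat_inv V in W - W * X * mat_inv (X\<^sup>T * W * X) * X\<^sup>T * W)"

text \<open>Nonzero determinants are required instead of positive definiteness because they persist
  on both sides of a point. With some \<gamma>_t = 0 every two-sided neighbourhood contains negative
  values of that parameter, and the score is an ordinary two-sided derivative.\<close>

definition gls_regular :: "nat \<Rightarrow> nat \<Rightarrow> real mat \<Rightarrow> real mat \<Rightarrow> bool" where
  "gls_regular N p X V \<longleftrightarrow> X \<in> carrier_mat N p \<and> V \<in> carrier_mat N N \<and> V\<^sup>T = V \<and> det V \<noteq> 0 \<and>
     det (X\<^sup>T * mat_inv V * X) \<noteq> 0"

text \<open>With W the inverse of V and G the inverse of \<open>X\<^sup>T * W * X\<close>, the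
  subtracted matrix H satisfies \<open>X\<^sup>T * H = X\<^sup>T * W\<close>, so X is annihilated.
  Moreover P V = I - \<open>W * X * G * X\<^sup>T\<close>, which acts as the identity on every Q
  with \<open>X\<^sup>T * Q = 0\<close>; that Q may come from a different V is the key to comparing
  two projections.\<close>

lemma gls_proj_props:
  assumes reg: "gls_regular N p X V"
  shows gls_proj_carrier: "gls_proj X V \<in> carrier_mat N N"
    and gls_proj_transpose: "(gls_proj X V)\<^sup>T = gls_proj X V"
    and transpose_mult_gls_proj: "X\<^sup>T * gls_proj X V = 0\<^sub>m p N"
    and gls_proj_mult: "gls_proj X V * X = 0\<^sub>m N p"
    and gls_proj_absorb: "\<And>Q. Q \<in> carrier_mat N N \<Longrightarrow> X\<^sup>T * Q = 0\<^sub>m p N \<Longrightarrow> gls_proj X V * V * Q = Q"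
proof -
  define W where "W = mat_inv V"
  define G where "G = mat_inv (X\<^sup>T * W * X)"
  define H where "H = W * X * G * X\<^sup>T * W"
  have X: "X \<in> carrier_mat N p" and V: "V \<in> carrier_mat N N" and symV: "V\<^sup>T = V"
    and dV: "det V \<noteq> 0" and dX: "det (X\<^sup>T * W * X) \<noteq> 0"
    using reg by (auto simp: gls_regular_def W_def)
  have W: "W \<in> carrier_mat N N" "V * W = 1\<^sub>m N" "W * V = 1\<^sub>m N"
    unfolding W_def using mat_inv_props[OF V dV] by auto
  have symW: "W\<^sup>T = W"
    unfolding W_def by (rule mat_inv_transpose[OF V dV symV])
  have Xt: "X\<^sup>T \<in> carrier_mat p N"
    using X by simp
  have XWX: "X\<^sup>T * W * X \<in> carrier_mat p p"
    using X W by simp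
  have "(X\<^sup>T * W * X)\<^sup>T = X\<^sup>T * (W * X)"
    using transpose_mult[OF mult_carrier_mat[OF Xt W(1)] X] transpose_mult[OF Xt W(1)] symW by simp
  then have symXWX: "(X\<^sup>T * W * X)\<^sup>T = X\<^sup>T * W * X"
    using X Xt W by simp
  have G: "G \<in> carrier_mat p p" "X\<^sup>T * W * X * G = 1\<^sub>m p" "G * (X\<^sup>T * W * X) = 1\<^sub>m p"
    unfolding G_def using mat_inv_props[OF XWX dX] by auto
  have symG: "G\<^sup>T = G"
    unfolding G_def by (rule mat_inv_transpose[OF XWX dX symXWX])
  have H: "H \<in> carrier_mat N N"
    unfolding H_def 
    by (rule mult_carrier_mat[OF mult_carrier_mat[OF mult_carrier_mat[OF mult_carrier_mat[OF W(1) X] G(1)] Xt] W(1)])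
  have P: "gls_proj X V = W - H"
    by (simp add: gls_proj_def H_def G_def W_def Let_def)
  show carr: "gls_proj X V \<in> carrier_mat N N"
    unfolding P using H by (rule minus_carrier_mat)
  have c: "W * X \<in> carrier_mat N p" "W * X * G \<in> carrier_mat N p" "W * X * G * X\<^sup>T \<in> carrier_mat N N"
    "X\<^sup>T * W \<in> carrier_mat p N" "G * (X\<^sup>T * W) \<in> carrier_mat p N" "X * G \<in> carrier_mat N p"
    using W X G by auto
  have H_eq: "H = W * (X * (G * (X\<^sup>T * W)))"
    unfolding H_def by (simp only: assoc_mult_mat[OF c(2) Xt W(1)] assoc_mult_mat[OF c(1) G(1) c(4)]
        assoc_mult_mat[OF W(1) X c(5)])
  have "H\<^sup>T = W\<^sup>T * (X\<^sup>T\<^sup>T * (G\<^sup>T * (X\<^sup>T * W\<^sup>T)))"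
    unfolding H_def
    by (simp only: transpose_mult[OF c(3) W(1)] transpose_mult[OF c(2) Xt] transpose_mult[OF c(1) G(1)]
        transpose_mult[OF W(1) X])
  also have "\<dots> = H"
    by (simp only: H_eq symW symG transpose_transpose)
  finally have symH: "H\<^sup>T = H" .
  show sym: "(gls_proj X V)\<^sup>T = gls_proj X V"
    unfolding P by (simp only: transpose_minus[OF W(1) H] symW symH)
  have "X\<^sup>T * H = X\<^sup>T * W * X * G * (X\<^sup>T * W)"
    by (simp only: H_eq assoc_mult_mat[OF XWX G(1) c(4)] assoc_mult_mat[OF c(4) X c(5)]
        assoc_mult_mat[OF Xt W(1) mult_carrier_mat[OF X c(5)]])
  also have "\<dots> = X\<^sup>T * W"
    by (simp only: G(2) left_mult_one_mat[OF c(4)])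
  finally have XH: "X\<^sup>T * H = X\<^sup>T * W" .
  show XP: "X\<^sup>T * gls_proj X V = 0\<^sub>m p N"
    by (simp only: P mult_minus_distrib_mat[OF Xt W(1) H] XH minus_r_inv_mat[OF c(4)])
  show "gls_proj X V * X = 0\<^sub>m N p"
    using transpose_mult[OF Xt carr] by (simp add: sym XP)
  fix Q :: "real mat" assume Q: "Q \<in> carrier_mat N N" and XQ: "X\<^sup>T * Q = 0\<^sub>m p N"
  have HV: "H * V = W * X * G * X\<^sup>T"
    by (simp only: H_def assoc_mult_mat[OF c(3) W(1) V] W(3) right_mult_one_mat[OF c(3)])
  have "gls_proj X V * V * Q = (1\<^sub>m N - W * X * G * X\<^sup>T) * Q"
    by (simp only: P minus_mult_distrib_mat[OF W(1) H V] HV W(3))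
  also have "\<dots> = Q - W * X * G * (X\<^sup>T * Q)"
    by (simp only: minus_mult_distrib_mat[OF one_carrier_mat c(3) Q] left_mult_one_mat[OF Q]
        assoc_mult_mat[OF c(2) Xt Q])
  also have "\<dots> = Q"
    unfolding XQ right_mult_zero_mat[OF c(2)] using Q by (intro eq_matI) auto
  finally show "gls_proj X V * V * Q = Q" .
qed

text \<open>For \<open>V' = V + h D\<close> with projections \<open>P\<close> and \<open>Q\<close>: \<open>P V Q = Q\<close> because
  \<open>X\<^sup>T Q = 0\<close>, and transposing \<open>Q V' P = P\<close> gives \<open>P V' Q = P\<close>; subtract. This yields the
  derivative of the quadratic form without differentiating an inverse.\<close>

lemma gls_proj_resolvent:
  assumes r1: "gls_regular N p X V" and r2: "gls_regular N p X (V + h \<cdot>\<^sub>m D)"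
    and D: "D \<in> carrier_mat N N"
  shows "gls_proj X V - gls_proj X (V + h \<cdot>\<^sub>m D) = h \<cdot>\<^sub>m (gls_proj X V * D * gls_proj X (V + h \<cdot>\<^sub>m D))"
proof -
  define V' where "V' = V + h \<cdot>\<^sub>m D"
  define P where "P = gls_proj X V"
  define Q where "Q = gls_proj X V'"
  note p1 = gls_proj_props[OF r1, folded P_def] and p2 = gls_proj_props[OF r2, folded V'_def, folded Q_def]
  have V: "V \<in> carrier_mat N N" and V': "V' \<in> carrier_mat N N" and symV': "V'\<^sup>T = V'"
    using r1 r2 by (auto simp: gls_regular_def V'_def)
  have PVQ: "P * V * Q = Q"
    by (rule p1(5)[OF p2(1) p2(3)])
  have QVP: "Q * V' * P = P"
    by (rule p2(5)[OF p1(1) p1(3)])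
  have hD: "h \<cdot>\<^sub>m D \<in> carrier_mat N N"
    using D by simp
  have c: "Q * V' \<in> carrier_mat N N" "P * V \<in> carrier_mat N N" "P * (h \<cdot>\<^sub>m D) \<in> carrier_mat N N"
    "P * D \<in> carrier_mat N N" "P * D * Q \<in> carrier_mat N N"
    using p1(1) p2(1) V V' D hD by (blast intro: mult_carrier_mat)+
  have "P = (Q * V' * P)\<^sup>T"
    by (simp only: QVP p1(2))
  also have "\<dots> = P * (V' * Q)"
    by (simp only: transpose_mult[OF c(1) p1(1)] transpose_mult[OF p2(1) V'] p1(2) p2(2) symV')
  also have "\<dots> = P * V' * Q"
    by (rule assoc_mult_mat[OF p1(1) V' p2(1), symmetric])
  also have "\<dots> = (P * V + P * (h \<cdot>\<^sub>m D)) * Q"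
    by (simp only: V'_def mult_add_distrib_mat[OF p1(1) V hD])
  also have "\<dots> = Q + P * (h \<cdot>\<^sub>m D) * Q"
    by (simp only: add_mult_distrib_mat[OF c(2,3) p2(1)] PVQ)
  also have "P * (h \<cdot>\<^sub>m D) * Q = h \<cdot>\<^sub>m (P * D * Q)"
    by (simp only: mult_smult_distrib[OF p1(1) D] mult_smult_assoc_mat[OF c(4) p2(1)])
  finally have eq: "P = Q + h \<cdot>\<^sub>m (P * D * Q)" .
  have "A - Q = B" if "A = Q + B" "B \<in> carrier_mat N N" for A B
    unfolding that(1) using p2(1) that(2) by (intro eq_matI) auto
  from this[OF eq] have "P - Q = h \<cdot>\<^sub>m (P * D * Q)"
    using c(5) by simp
  then show ?thesis
    by (simp only: P_def Q_def V'_def)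
qed

lemma mat_tendsto_affine:
  assumes "V \<in> carrier_mat N N" "D \<in> carrier_mat N N"
  shows "mat_tendsto N N (\<lambda>x. V + (x - a) \<cdot>\<^sub>m D) V (at a)"
proof (rule mat_tendstoI[where g = "\<lambda>i j x. V $$ (i, j) + (x - a) * D $$ (i, j)"])
  fix i j
  have "((\<lambda>x. V $$ (i, j) + (x - a) * D $$ (i, j)) \<longlongrightarrow> V $$ (i, j) + (a - a) * D $$ (i, j)) (at a)"
    by (intro tendsto_intros)
  then show "((\<lambda>x. V $$ (i, j) + (x - a) * D $$ (i, j)) \<longlongrightarrow> V $$ (i, j)) (at a)"
    by simp
qed (use assms in auto)

lemma mat_tendsto_gls_gram:
  assumes "gls_regular N p X L" "mat_tendsto N N V L F"
  shows "mat_tendsto p p (\<lambda>x. X\<^sup>T * mat_inv (V x) * X) (X\<^sup>T * mat_inv L * X) F"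
proof -
  have "X \<in> carrier_mat N p" "det L \<noteq> 0"
    using assms by (auto simp: gls_regular_def)
  then show ?thesis
    using assms(2) by (intro mat_tendsto_mult[of _ N] mat_tendsto_const mat_tendsto_inv) auto
qed

lemma mat_tendsto_gls_proj:
  assumes "gls_regular N p X L" "mat_tendsto N N V L F"
  shows "mat_tendsto N N (\<lambda>x. gls_proj X (V x)) (gls_proj X L) F"
proof -
  have X: "X \<in> carrier_mat N p" "X\<^sup>T \<in> carrier_mat p N"
    and d: "det L \<noteq> 0" "det (X\<^sup>T * mat_inv L * X) \<noteq> 0"
    using assms by (auto simp: gls_regular_def)
  note W = mat_tendsto_inv[OF assms(2) d(1)]
  note G = mat_tendsto_inv[OF mat_tendsto_gls_gram[OF assms] d(2)]
  show ?thesis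
    unfolding gls_proj_def Let_def
    by (intro mat_tendsto_minus W mat_tendsto_mult[OF mat_tendsto_mult[OF mat_tendsto_mult[OF
          mat_tendsto_mult[OF W mat_tendsto_const[OF X(1)]] G] mat_tendsto_const[OF X(2)]] W])
qed

text \<open>Both determinants in \<open>gls_regular\<close> are continuous along the line and
  nonzero at its base point; symmetry holds all along the line.\<close>

lemma eventually_gls_regular:
  assumes reg: "gls_regular N p X V" and D: "D \<in> carrier_mat N N" "D\<^sup>T = D"
  shows "\<forall>\<^sub>F x in at a. gls_regular N p X (V + (x - a) \<cdot>\<^sub>m D)"
proof -
  have V: "X \<in> carrier_mat N p" "V \<in> carrier_mat N N" "V\<^sup>T = V" "det V \<noteq> 0" "det (X\<^sup>T * mat_inv V * X) \<noteq> 0"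
    using reg by (auto simp: gls_regular_def)
  note lim = mat_tendsto_affine[OF V(2) D(1)]
  have sym: "(V + (x - a) \<cdot>\<^sub>m D)\<^sup>T = V + (x - a) \<cdot>\<^sub>m D" for x
  proof (rule eq_matI)
    fix i j assume "i < dim_row (V + (x - a) \<cdot>\<^sub>m D)" "j < dim_col (V + (x - a) \<cdot>\<^sub>m D)"
    then have ij: "i < N" "j < N"
      using D by auto
    have "V\<^sup>T $$ (i, j) = V $$ (i, j)" "D\<^sup>T $$ (i, j) = D $$ (i, j)"
      by (simp_all add: V D)
    then show "(V + (x - a) \<cdot>\<^sub>m D)\<^sup>T $$ (i, j) = (V + (x - a) \<cdot>\<^sub>m D) $$ (i, j)"
      using V(2) D(1) ij by simp
  qed (use V(2) D(1) in auto)
  show ?thesis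
    using eventually_det_nonzero[OF lim V(4)]
      eventually_det_nonzero[OF mat_tendsto_gls_gram[OF reg lim] V(5)]
    by eventually_elim (auto simp: gls_regular_def V(1) sym)
qed

text \<open>By the resolvent identity the difference quotient equals - y' P D Q(x) y exactly, with
  no remainder, so continuity of Q at a is all that the limit requires.\<close>

lemma gls_quad_form_has_derivative:
  assumes reg: "gls_regular N p X V" and D: "D \<in> carrier_mat N N" "D\<^sup>T = D" and y: "y \<in> carrier_vec N"
  shows "((\<lambda>x. y \<bullet> (gls_proj X (V + (x - a) \<cdot>\<^sub>m D) *\<^sub>v y)) has_real_derivative
    - (y \<bullet> ((gls_proj X V * D * gls_proj X V) *\<^sub>v y))) (at a)"
proof -
  define Q where "Q x = gls_proj X (V + (x - a) \<cdot>\<^sub>m D)" for x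
  define P where "P = gls_proj X V"
  have V: "V \<in> carrier_mat N N"
    using reg by (simp add: gls_regular_def)
  have P: "P \<in> carrier_mat N N"
    unfolding P_def using reg by (rule gls_proj_carrier)
  have Qa: "Q a = P"
  proof -
    have "V + (a - a) \<cdot>\<^sub>m D = V"
      using V D by (auto intro!: eq_matI)
    then show ?thesis
      by (simp add: Q_def P_def)
  qed
  have "mat_tendsto N N (\<lambda>x. P * D * Q x) (P * D * P) (at a)"
    unfolding Q_def
    by (intro mat_tendsto_mult[of N N _ _ _ N] mat_tendsto_const P D
        mat_tendsto_gls_proj[OF reg, folded P_def] mat_tendsto_affine[OF V D(1)])
  then have lim: "((\<lambda>x. - (y \<bullet> ((P * D * Q x) *\<^sub>v y))) \<longlongrightarrow> - (y \<bullet> ((P * D * P) *\<^sub>v y))) (at a)"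
    by (intro tendsto_minus tendsto_quad_form[OF _ y])
  have "\<forall>\<^sub>F x in at a. x \<noteq> a"
    by (simp add: eventually_at_filter)
  with eventually_gls_regular[OF reg D]
  have "\<forall>\<^sub>F x in at a. - (y \<bullet> ((P * D * Q x) *\<^sub>v y)) =
      (y \<bullet> (Q x *\<^sub>v y) - y \<bullet> (Q a *\<^sub>v y)) / (x - a)"
  proof eventually_elim
    case (elim x)
    have Q: "Q x \<in> carrier_mat N N"
      unfolding Q_def using elim(1) by (rule gls_proj_carrier)
    have PDQ: "P * D * Q x \<in> carrier_mat N N"
      using P D Q by simp
    have eq: "P - Q x = (x - a) \<cdot>\<^sub>m (P * D * Q x)"
      unfolding P_def Q_def by (rule gls_proj_resolvent[OF reg elim(1) D(1)])
    have "P $$ (i, j) - Q x $$ (i, j) = (x - a) * (P * D * Q x) $$ (i, j)" if "i < N" "j < N" for i j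
      using arg_cong[OF eq, of "\<lambda>A. A $$ (i, j)"] P Q PDQ that by auto
    then have "y \<bullet> (P *\<^sub>v y) - y \<bullet> (Q x *\<^sub>v y) = (x - a) * (y \<bullet> ((P * D * Q x) *\<^sub>v y))"
      unfolding quad_form_sum[OF P y] quad_form_sum[OF Q y] quad_form_sum[OF PDQ y]
      by (simp add: sum_distrib_left flip: sum_subtractf mult.assoc left_diff_distrib)
    then show ?case
      using elim(2) by (simp add: Qa field_simps)
  qed
  from Lim_transform_eventually[OF lim this]
  show ?thesis
    unfolding has_field_derivative_iff P_def[symmetric] Q_def[symmetric] .
qed

text \<open>The negative case rests on \<open>ln (- x) = ln x\<close>. Thus the sign of the
  determinant in the likelihood never has to be found; it is enough that it is nonzero.\<close>

lemma DERIV_ln_nonzero: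
  fixes x :: real
  assumes "x \<noteq> 0"
  shows "(ln has_real_derivative 1 / x) (at x)"
proof (cases "x > 0")
  case True
  then show ?thesis
    using DERIV_ln_divide by blast
next
  case False
  with assms have "((\<lambda>x. ln (- x)) has_real_derivative 1 / x) (at x)"
    by (auto intro!: derivative_eq_intros)
  then show ?thesis
    by (simp add: ln_minus)
qed

text \<open>The matrix inside the determinant is again affine in x, with base point
  \<open>T\<^sup>T * V * T\<close> and slope \<open>T\<^sup>T * D * T\<close>. At x = a it is
  positive definite by congruence, so the logarithm is differentiable there.\<close>

lemma restricted_det_differentiable:
  assumes "pos_def_mat N V" and D: "D \<in> carrier_mat N N" and T: "T \<in> carrier_mat N q"
    and inj: "\<And>v. v \<in> carrier_vec q \<Longrightarrow> T *\<^sub>v v = 0\<^sub>v N \<Longrightarrow> v = 0\<^sub>v q"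
  shows "(\<lambda>x. ln (det (T\<^sup>T * (V + (x - a) \<cdot>\<^sub>m D) * T))) field_differentiable (at a)"
proof -
  have V: "V \<in> carrier_mat N N"
    using assms by (simp add: pos_def_mat_def)
  define G where "G = T\<^sup>T * V * T"
  define E where "E = T\<^sup>T * D * T"
  have c: "G \<in> carrier_mat q q" "E \<in> carrier_mat q q" "T\<^sup>T * V \<in> carrier_mat q N" "T\<^sup>T * D \<in> carrier_mat q N"
    using V D T by (auto simp: G_def E_def)
  have "T\<^sup>T * (V + h \<cdot>\<^sub>m D) * T = G + h \<cdot>\<^sub>m E" for h
  proof -
    have "T\<^sup>T * (V + h \<cdot>\<^sub>m D) = T\<^sup>T * V + h \<cdot>\<^sub>m (T\<^sup>T * D)"
      using V D T by (simp add: mult_add_distrib_mat[of _ q N] mult_smult_distrib[of _ q N _ N])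
    then show ?thesis
      using c T by (simp add: add_mult_distrib_mat[of _ q N] mult_smult_assoc_mat[of _ q N _ q] G_def E_def)
  qed
  then have eq: "(\<lambda>x. det (T\<^sup>T * (V + (x - a) \<cdot>\<^sub>m D) * T)) = (\<lambda>x. det (G + (x - a) \<cdot>\<^sub>m E))"
    by simp
  have "G + (a - a) \<cdot>\<^sub>m E = G"
    using c by (auto intro!: eq_matI)
  then have nz: "det (G + (a - a) \<cdot>\<^sub>m E) \<noteq> 0"
    using pos_def_mat_det[OF pos_def_mat_congruence[OF assms(1) T inj]] by (simp add: G_def)
  obtain d where "((\<lambda>x. det (G + (x - a) \<cdot>\<^sub>m E)) has_real_derivative d) (at a)"
    using field_differentiable_det_affine[OF c(1,2)] unfolding field_differentiable_def by blast
  then have "((\<lambda>x. ln (det (G + (x - a) \<cdot>\<^sub>m E))) has_real_derivative d / det (G + (a - a) \<cdot>\<^sub>m E)) (at a)"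
    using DERIV_chain2[where g = "\<lambda>x. det (G + (x - a) \<cdot>\<^sub>m E)", OF DERIV_ln_nonzero[OF nz]] by simp
  then show ?thesis
    unfolding field_differentiable_def eq[THEN fun_cong] by blast
qed

section \<open>The restricted likelihood score\<close>

text \<open>The form is the squared length of \<open>A\<^sup>T *\<^sub>v v\<close>.\<close>

lemma gram_quad_form_nonneg:
  fixes A :: "real mat"
  assumes "A \<in> carrier_mat n m" "v \<in> carrier_vec n"
  shows "v \<bullet> ((A * A\<^sup>T) *\<^sub>v v) \<ge> 0"
proof -
  have At: "A\<^sup>T \<in> carrier_mat m n" and Av: "A\<^sup>T *\<^sub>v v \<in> carrier_vec m"
    using assms by auto
  have "v \<bullet> ((A * A\<^sup>T) *\<^sub>v v) = v \<bullet> (A *\<^sub>v (A\<^sup>T *\<^sub>v v))"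
    using assoc_mult_mat_vec[OF assms(1) At assms(2)] by simp
  also have "\<dots> = (A\<^sup>T *\<^sub>v v) \<bullet> (A\<^sup>T *\<^sub>v v)"
    using scalar_prod_mult_transpose[OF At assms(2) Av] by simp
  also have "\<dots> \<ge> 0"
    by (auto simp: scalar_prod_def intro!: sum_nonneg)
  finally show ?thesis .
qed

lemma scalar_prod_self_pos:
  fixes v :: "real vec"
  assumes "v \<in> carrier_vec n" "v \<noteq> 0\<^sub>v n"
  shows "v \<bullet> v > 0"
proof -
  obtain i where i: "i < n" "v $ i \<noteq> 0"
    using assms by (auto simp: vec_eq_iff)
  then have "0 < v $ i * v $ i"
    by (auto simp: zero_less_mult_iff)
  then show ?thesis
    using assms i unfolding scalar_prod_def
    by (intro sum_pos2[of _ i]) auto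
qed

lemma var_mat_carrier: "var_mat N s Z \<theta> \<in> carrier_mat N N"
  by (simp add: var_mat_def)

lemma mult_transpose_symmetric:
  fixes A :: "real mat"
  assumes "A \<in> carrier_mat n m"
  shows "(A * A\<^sup>T)\<^sup>T = A * A\<^sup>T"
  using transpose_mult[OF assms, of "A\<^sup>T" n] assms by simp

lemma var_mat_transpose:
  assumes "\<forall>t\<le>s. Z t \<in> carrier_mat N (m t)"
  shows "(var_mat N s Z \<theta>)\<^sup>T = var_mat N s Z \<theta>"
proof (rule eq_matI)
  fix i j assume "i < dim_row (var_mat N s Z \<theta>)" "j < dim_col (var_mat N s Z \<theta>)"
  then have ij: "i < N" "j < N"
    by (auto simp: var_mat_def)
  have "(Z t * (Z t)\<^sup>T) $$ (j, i) = (Z t * (Z t)\<^sup>T) $$ (i, j)" if "t \<le> s" for t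
  proof -
    have "(Z t * (Z t)\<^sup>T) $$ (j, i) = (Z t * (Z t)\<^sup>T)\<^sup>T $$ (j, i)"
      using mult_transpose_symmetric[OF assms[rule_format, OF that]] by simp
    also have "\<dots> = (Z t * (Z t)\<^sup>T) $$ (i, j)"
      using assms[rule_format, OF that] ij by (subst index_transpose_mat) auto
    finally show ?thesis .
  qed
  then show "(var_mat N s Z \<theta>)\<^sup>T $$ (i, j) = var_mat N s Z \<theta> $$ (i, j)"
    using ij by (auto simp: var_mat_def simp del: index_mult_mat intro!: sum.cong)
qed (auto simp: var_mat_def)

text \<open>The quadratic form at v is \<theta>_0 times the sum of |v|^2 and the nonnegative terms
  \<theta>_t |Z_t' v|^2. The identity matrix contributed by the errors gives strictness, so
  vanishing variance components are allowed.\<close>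

lemma var_mat_pos_def:
  assumes Z: "\<forall>t\<le>s. Z t \<in> carrier_mat N (m t)"
    and pos: "\<theta> 0 > 0" "\<forall>t\<le>s. \<theta> t \<ge> 0"
  shows "pos_def_mat N (var_mat N s Z \<theta>)"
  unfolding pos_def_mat_def
proof (intro conjI ballI impI)
  fix v :: "real vec" assume v: "v \<in> carrier_vec N" "v \<noteq> 0\<^sub>v N"
  have c: "Z t * (Z t)\<^sup>T \<in> carrier_mat N N" if "t \<le> s" for t
    using Z[rule_format, OF that] by simp
  have "v \<bullet> (var_mat N s Z \<theta> *\<^sub>v v) =
      (\<Sum>i<N. \<Sum>j<N. (\<theta> 0 * (1\<^sub>m N $$ (i, j) + (\<Sum>t=1..s. \<theta> t * (Z t * (Z t)\<^sup>T) $$ (i, j)))) * (v $ i * v $ j))"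
    unfolding quad_form_sum[OF var_mat_carrier v(1)] by (simp add: var_mat_def del: index_mult_mat)
  also have "\<dots> = \<theta> 0 * ((\<Sum>i<N. \<Sum>j<N. 1\<^sub>m N $$ (i, j) * (v $ i * v $ j)) +
      (\<Sum>i<N. \<Sum>j<N. \<Sum>t=1..s. \<theta> t * ((Z t * (Z t)\<^sup>T) $$ (i, j) * (v $ i * v $ j))))"
    by (simp add: sum_distrib_left sum_distrib_right distrib_left distrib_right sum.distrib mult.assoc
        del: index_mult_mat index_one_mat)
  also have "(\<Sum>i<N. \<Sum>j<N. \<Sum>t=1..s. \<theta> t * ((Z t * (Z t)\<^sup>T) $$ (i, j) * (v $ i * v $ j))) =
      (\<Sum>t=1..s. \<theta> t * (\<Sum>i<N. \<Sum>j<N. (Z t * (Z t)\<^sup>T) $$ (i, j) * (v $ i * v $ j)))"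
    unfolding sum_distrib_left by (simp only: sum.swap[where A = "{..<N}" and B = "{1..s}"])
  also have "\<dots> = (\<Sum>t=1..s. \<theta> t * (v \<bullet> ((Z t * (Z t)\<^sup>T) *\<^sub>v v)))"
    by (intro sum.cong refl) (simp add: quad_form_sum[OF c v(1)] del: index_mult_mat)
  also have "(\<Sum>i<N. \<Sum>j<N. 1\<^sub>m N $$ (i, j) * (v $ i * v $ j)) = v \<bullet> v"
    using quad_form_sum[OF one_carrier_mat v(1)] v(1) by simp
  finally have "v \<bullet> (var_mat N s Z \<theta> *\<^sub>v v) =
      \<theta> 0 * (v \<bullet> v + (\<Sum>t=1..s. \<theta> t * (v \<bullet> ((Z t * (Z t)\<^sup>T) *\<^sub>v v))))" .
  moreover have "(\<Sum>t=1..s. \<theta> t * (v \<bullet> ((Z t * (Z t)\<^sup>T) *\<^sub>v v))) \<ge> 0"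
    using Z v pos by (intro sum_nonneg mult_nonneg_nonneg gram_quad_form_nonneg) auto
  moreover have "v \<bullet> v > 0"
    using v by (rule scalar_prod_self_pos)
  ultimately show "v \<bullet> (var_mat N s Z \<theta> *\<^sub>v v) > 0"
    using pos(1) by (simp add: add_pos_nonneg)
qed (rule var_mat_carrier)

text \<open>The case j = 0 is separate because \<lambda> is a common factor of all of V, which makes
  the derivative in \<lambda> equal to V / \<lambda>.\<close>

definition var_mat_deriv :: "nat \<Rightarrow> nat \<Rightarrow> (nat \<Rightarrow> real mat) \<Rightarrow> (nat \<Rightarrow> real) \<Rightarrow> nat \<Rightarrow> real mat" where
  "var_mat_deriv N s Z \<theta> j =
     (if j = 0 then (1 / \<theta> 0) \<cdot>\<^sub>m var_mat N s Z \<theta> else \<theta> 0 \<cdot>\<^sub>m (Z j * (Z j)\<^sup>T))"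

lemma var_mat_deriv_props:
  assumes "\<forall>t\<le>s. Z t \<in> carrier_mat N (m t)" "j \<le> s"
  shows "var_mat_deriv N s Z \<theta> j \<in> carrier_mat N N"
    and "(var_mat_deriv N s Z \<theta> j)\<^sup>T = var_mat_deriv N s Z \<theta> j"
proof -
  have ts: "(a \<cdot>\<^sub>m A)\<^sup>T = a \<cdot>\<^sub>m A\<^sup>T" for a and A :: "real mat"
    by (rule eq_matI) auto
  show "var_mat_deriv N s Z \<theta> j \<in> carrier_mat N N"
    using assms(1)[rule_format, OF assms(2)] by (auto simp: var_mat_deriv_def var_mat_carrier)
  show "(var_mat_deriv N s Z \<theta> j)\<^sup>T = var_mat_deriv N s Z \<theta> j"
    by (simp add: var_mat_deriv_def ts var_mat_transpose[OF assms(1)]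
        mult_transpose_symmetric[OF assms(1)[rule_format, OF assms(2)]])
qed

text \<open>In \<theta> the entries of V consist of \<theta>_0 and products \<theta>_0 \<theta>_t
  with t > 0. Changing one coordinate is therefore an exactly affine move, as the resolvent identity
  demands.\<close>

lemma var_mat_upd:
  assumes Z: "\<forall>t\<le>s. Z t \<in> carrier_mat N (m t)" and "j \<le> s" "\<theta> 0 \<noteq> 0"
  shows "var_mat N s Z (\<theta>(j := x)) = var_mat N s Z \<theta> + (x - \<theta> j) \<cdot>\<^sub>m var_mat_deriv N s Z \<theta> j"
proof (rule eq_matI)
  note D = var_mat_deriv_props(1)[OF Z \<open>j \<le> s\<close>, where \<theta> = \<theta>]
  have dims: "dim_row (var_mat_deriv N s Z \<theta> j) = N" "dim_col (var_mat_deriv N s Z \<theta> j) = N"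
    using D by auto
  fix i i' assume "i < dim_row (var_mat N s Z \<theta> + (x - \<theta> j) \<cdot>\<^sub>m var_mat_deriv N s Z \<theta> j)"
    "i' < dim_col (var_mat N s Z \<theta> + (x - \<theta> j) \<cdot>\<^sub>m var_mat_deriv N s Z \<theta> j)"
  then have ii: "i < N" "i' < N"
    using dims by auto
  define w where "w t = (Z t * (Z t)\<^sup>T) $$ (i, i')" for t
  have V: "var_mat N s Z \<eta> $$ (i, i') = \<eta> 0 * (1\<^sub>m N $$ (i, i') + (\<Sum>t=1..s. \<eta> t * w t))" for \<eta>
    using ii by (simp add: var_mat_def w_def)
  show "var_mat N s Z (\<theta>(j := x)) $$ (i, i') =
      (var_mat N s Z \<theta> + (x - \<theta> j) \<cdot>\<^sub>m var_mat_deriv N s Z \<theta> j) $$ (i, i')"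
  proof (cases "j = 0")
    case True
    \<comment> \<open>The sum starts at t = 1 and does not see the changed coordinate 0.\<close>
    have "(\<Sum>t=1..s. (\<theta>(0 := x)) t * w t) = (\<Sum>t=1..s. \<theta> t * w t)"
      by (intro sum.cong) auto
    then show ?thesis
      using ii dims True \<open>\<theta> 0 \<noteq> 0\<close> var_mat_carrier[of N s Z \<theta>]
      by (simp add: V var_mat_deriv_def field_simps del: index_one_mat)
  next
    case False
    have "(\<Sum>t=1..s. (\<theta>(j := x)) t * w t) = (\<Sum>t=1..s. \<theta> t * w t + (if t = j then (x - \<theta> j) * w j else 0))"
      by (intro sum.cong) (auto simp: algebra_simps)
    also have "\<dots> = (\<Sum>t=1..s. \<theta> t * w t) + (x - \<theta> j) * w j"
      using False \<open>j \<le> s\<close> by (simp add: sum.distrib)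
    finally have "(\<Sum>t=1..s. (\<theta>(j := x)) t * w t) = (\<Sum>t=1..s. \<theta> t * w t) + (x - \<theta> j) * w j" .
    then have "var_mat N s Z (\<theta>(j := x)) $$ (i, i') =
        \<theta> 0 * (1\<^sub>m N $$ (i, i') + ((\<Sum>t=1..s. \<theta> t * w t) + (x - \<theta> j) * w j))"
      using False by (simp only: V fun_upd_other)
    moreover have "var_mat_deriv N s Z \<theta> j $$ (i, i') = \<theta> 0 * w j"
      using False ii Z[rule_format, OF \<open>j \<le> s\<close>] by (simp add: var_mat_deriv_def w_def)
    ultimately show ?thesis
      using ii dims False var_mat_carrier[of N s Z \<theta>]
      by (simp add: V distrib_left mult.left_commute del: index_one_mat)
  qed
qed (use var_mat_deriv_props(1)[OF Z \<open>j \<le> s\<close>, where \<theta> = \<theta>] in \<open>auto simp: var_mat_def\<close>)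

text \<open>Positive definiteness passes from V to its inverse and then, X being injective by full
  column rank, to the weighted Gram matrix of X.\<close>

lemma var_mat_gls_regular:
  assumes Z: "\<forall>t\<le>s. Z t \<in> carrier_mat N (m t)"
    and pos: "\<theta> 0 > 0" "\<forall>t\<le>s. \<theta> t \<ge> 0"
    and X: "X \<in> carrier_mat N p" "vec_space.rank N X = p"
  shows "gls_regular N p X (var_mat N s Z \<theta>)"
proof -
  have pd: "pos_def_mat N (var_mat N s Z \<theta>)"
    using Z pos by (rule var_mat_pos_def)
  have sym: "(var_mat N s Z \<theta>)\<^sup>T = var_mat N s Z \<theta>"
    using Z by (rule var_mat_transpose)
  have "pos_def_mat p (X\<^sup>T * mat_inv (var_mat N s Z \<theta>) * X)"
    by (rule pos_def_mat_congruence[OF pos_def_mat_inv[OF pd sym] X(1)])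
      (rule full_column_rank_injective[OF X])
  then show ?thesis
    using X(1) sym pd by (simp add: gls_regular_def var_mat_carrier pos_def_mat_det)
qed

text \<open>Both cases in the definition of B_j are half of P (dV/d\<theta>_j) P. For j = 0 this
  uses P V P = P, the absorption property with Q = P.\<close>

lemma B_mat_eq:
  assumes Z: "\<forall>t\<le>s. Z t \<in> carrier_mat N (m t)" and j: "j \<le> s"
    and reg: "gls_regular N p X (var_mat N s Z \<theta>)"
  shows "B_mat N s X Z \<theta> j = (1 / 2) \<cdot>\<^sub>m (gls_proj X (var_mat N s Z \<theta>) *
    var_mat_deriv N s Z \<theta> j * gls_proj X (var_mat N s Z \<theta>))"
proof -
  define V where "V = var_mat N s Z \<theta>"
  define P where "P = gls_proj X V"
  note P = gls_proj_props[OF reg, folded V_def, folded P_def]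
  have PB: "P_mat N s X Z \<theta> = P"
    by (simp add: P_mat_def P_def gls_proj_def V_def)
  have V: "V \<in> carrier_mat N N"
    by (simp add: V_def var_mat_carrier)
  have PVP: "P * V * P = P"
    by (rule P(5)[OF P(1) P(3)])
  have sm: "P * (a \<cdot>\<^sub>m A) * P = a \<cdot>\<^sub>m (P * A * P)" if "A \<in> carrier_mat N N" for a A
    by (simp only: mult_smult_distrib[OF P(1) that] mult_smult_assoc_mat[OF mult_carrier_mat[OF P(1) that] P(1)])
  have ss: "a \<cdot>\<^sub>m (b \<cdot>\<^sub>m A) = (a * b) \<cdot>\<^sub>m A" for a b and A :: "real mat"
    by (rule eq_matI) auto
  show ?thesis
  proof (cases "j = 0")
    case True
    have "1 / (2 * \<theta> 0) = 1 / 2 * (1 / \<theta> 0)"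
      by simp
    then show ?thesis
      unfolding B_mat_def var_mat_deriv_def V_def[symmetric] P_def[symmetric] PB
      by (simp only: True simp_thms if_True sm[OF V] PVP ss)
  next
    case False
    have Zj: "Z j \<in> carrier_mat N (m j)" "(Z j)\<^sup>T \<in> carrier_mat (m j) N" "Z j * (Z j)\<^sup>T \<in> carrier_mat N N"
      using Z[rule_format, OF j] by auto
    have "\<theta> 0 / 2 = 1 / 2 * \<theta> 0"
      by simp
    with False show ?thesis
      unfolding B_mat_def var_mat_deriv_def V_def[symmetric] P_def[symmetric] PB
      by (simp only: if_False sm[OF Zj(3)] ss assoc_mult_mat[OF P(1) Zj(1,2)])
  qed
qed

lemma B_mat_props:
  assumes Z: "\<forall>t\<le>s. Z t \<in> carrier_mat N (m t)" and j: "j \<le> s"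
    and reg: "gls_regular N p X (var_mat N s Z \<theta>)"
  shows B_mat_carrier: "B_mat N s X Z \<theta> j \<in> carrier_mat N N"
    and B_mat_transpose: "(B_mat N s X Z \<theta> j)\<^sup>T = B_mat N s X Z \<theta> j"
    and B_mat_mult: "B_mat N s X Z \<theta> j * X = 0\<^sub>m N p"
proof -
  define P where "P = gls_proj X (var_mat N s Z \<theta>)"
  define D where "D = var_mat_deriv N s Z \<theta> j"
  have X: "X \<in> carrier_mat N p"
    using reg by (simp add: gls_regular_def)
  note P = gls_proj_props[OF reg, folded P_def]
  note D = var_mat_deriv_props[OF Z j, where \<theta> = \<theta>, folded D_def]
  note B = B_mat_eq[OF Z j reg, folded P_def D_def]
  have c: "P * D \<in> carrier_mat N N" "P * D * P \<in> carrier_mat N N"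
    using P D by auto
  have ts: "(a \<cdot>\<^sub>m A)\<^sup>T = a \<cdot>\<^sub>m A\<^sup>T" for a and A :: "real mat"
    by (rule eq_matI) auto
  show "B_mat N s X Z \<theta> j \<in> carrier_mat N N"
    unfolding B using c(2) by simp
  have "(P * D * P)\<^sup>T = P * (D * P)"
    by (simp only: transpose_mult[OF c(1) P(1)] transpose_mult[OF P(1) D(1)] P(2) D(2))
  also have "\<dots> = P * D * P"
    by (rule assoc_mult_mat[OF P(1) D(1) P(1), symmetric])
  finally show "(B_mat N s X Z \<theta> j)\<^sup>T = B_mat N s X Z \<theta> j"
    unfolding B ts by (rule arg_cong)
  show "B_mat N s X Z \<theta> j * X = 0\<^sub>m N p"
    unfolding B mult_smult_assoc_mat[OF c(2) X] assoc_mult_mat[OF c(1) P(1) X] P(4)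
      right_mult_zero_mat[OF c(1)]
    by (intro eq_matI) auto
qed

text \<open>The order of the quantifiers matters: C is chosen before y, so after inserting the
  random response it is a deterministic constant that the covariance ignores.\<close>

lemma restricted_loglik_partial_deriv:
  assumes Z: "\<forall>t\<le>s. Z t \<in> carrier_mat N (m t)" and j: "j \<le> s"
    and pos: "\<theta> 0 > 0" "\<forall>t\<le>s. \<theta> t \<ge> 0"
    and X: "X \<in> carrier_mat N p" "vec_space.rank N X = p"
    and T: "T \<in> carrier_mat N q" "vec_space.rank N T = q"
  obtains C where "\<And>y. y \<in> carrier_vec N \<Longrightarrow>
    partial_deriv j (restricted_loglik c0 T N s X Z y) \<theta> = C + y \<bullet> (B_mat N s X Z \<theta> j *\<^sub>v y)"
proof -
  define V where "V = var_mat N s Z \<theta>"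
  define D where "D = var_mat_deriv N s Z \<theta> j"
  define P where "P = gls_proj X V"
  have reg: "gls_regular N p X V"
    unfolding V_def using assms by (intro var_mat_gls_regular)
  note D = var_mat_deriv_props[OF Z j, where \<theta> = \<theta>, folded D_def]
  have upd: "var_mat N s Z (\<theta>(j := x)) = V + (x - \<theta> j) \<cdot>\<^sub>m D" for x
    unfolding V_def D_def using Z j pos(1) by (intro var_mat_upd) auto
  have "pos_def_mat N V"
    unfolding V_def using Z pos by (rule var_mat_pos_def)
  then have "(\<lambda>x. ln (det (T\<^sup>T * (V + (x - \<theta> j) \<cdot>\<^sub>m D) * T))) field_differentiable (at (\<theta> j))"
    by (rule restricted_det_differentiable[OF _ D(1) T(1) full_column_rank_injective[OF T]])
  then obtain d where d: "((\<lambda>x. ln (det (T\<^sup>T * (V + (x - \<theta> j) \<cdot>\<^sub>m D) * T))) has_real_derivative d) (at (\<theta> j))"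
    unfolding field_differentiable_def by blast
  have P: "P \<in> carrier_mat N N"
    unfolding P_def by (rule gls_proj_carrier[OF reg])
  have B: "B_mat N s X Z \<theta> j = (1 / 2) \<cdot>\<^sub>m (P * D * P)"
    using B_mat_eq[OF Z j] reg by (simp add: P_def D_def V_def)
  show thesis
  \<comment> \<open>Here d is the derivative of the log-determinant, which does not involve
    y.\<close>
  proof (rule that[of "- 1/2 * d"])
    fix y :: "real vec" assume y: "y \<in> carrier_vec N"
    note q = gls_quad_form_has_derivative[OF reg D y, of "\<theta> j"]
    have c: "P * D * P \<in> carrier_mat N N"
      using P D by auto
    have "partial_deriv j (restricted_loglik c0 T N s X Z y) \<theta> =
        deriv (\<lambda>x. c0 - 1/2 * (ln (det (T\<^sup>T * (V + (x - \<theta> j) \<cdot>\<^sub>m D) * T)) +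
          y \<bullet> (gls_proj X (V + (x - \<theta> j) \<cdot>\<^sub>m D) *\<^sub>v y))) (\<theta> j)"
      by (simp add: partial_deriv_def restricted_loglik_def upd P_mat_def gls_proj_def)
    also have "\<dots> = 0 - 1/2 * (d + - (y \<bullet> ((P * D * P) *\<^sub>v y)))"
      unfolding P_def
      by (intro DERIV_imp_deriv DERIV_diff DERIV_const DERIV_cmult DERIV_add d q)
    also have "y \<bullet> ((P * D * P) *\<^sub>v y) = 2 * (y \<bullet> (B_mat N s X Z \<theta> j *\<^sub>v y))"
      using c B_mat_carrier[OF Z j] reg
      by (simp add: quad_form_sum[OF c y] quad_form_sum[OF _ y, of "B_mat N s X Z \<theta> j"] V_def)
        (simp add: B sum_distrib_left del: index_mult_mat)
    finally show "partial_deriv j (restricted_loglik c0 T N s X Z y) \<theta> =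
        - 1/2 * d + y \<bullet> (B_mat N s X Z \<theta> j *\<^sub>v y)"
      by (simp add: field_simps)
  qed
qed

text \<open>\<open>B * X = 0\<close> removes the fixed part from the right argument, and the
  symmetry of B moves this to the left argument.\<close>

lemma quad_form_shift:
  fixes B :: "real mat"
  assumes B: "B \<in> carrier_mat N N" "B\<^sup>T = B" "B * X = 0\<^sub>m N p"
    and X: "X \<in> carrier_mat N p" and \<beta>: "\<beta> \<in> carrier_vec p" and y: "y \<in> carrier_vec N"
  shows "y \<bullet> (B *\<^sub>v y) = (y - X *\<^sub>v \<beta>) \<bullet> (B *\<^sub>v (y - X *\<^sub>v \<beta>))"
proof -
  define u where "u = y - X *\<^sub>v \<beta>"
  have X\<beta>: "X *\<^sub>v \<beta> \<in> carrier_vec N" and u: "u \<in> carrier_vec N"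
    using X \<beta> y by (auto simp: u_def)
  have "B *\<^sub>v (X *\<^sub>v \<beta>) = (B * X) *\<^sub>v \<beta>"
    using assoc_mult_mat_vec[OF B(1) X \<beta>] by simp
  also have "\<dots> = 0\<^sub>v N"
    unfolding B(3) using \<beta> by (intro eq_vecI) (auto simp: scalar_prod_def)
  finally have BX\<beta>: "B *\<^sub>v (X *\<^sub>v \<beta>) = 0\<^sub>v N" .
  have Bu: "B *\<^sub>v u = B *\<^sub>v y"
    unfolding u_def mult_minus_distrib_mat_vec[OF B(1) y X\<beta>] BX\<beta> using B(1) y by (intro minus_zero_vec) auto
  then have "y \<bullet> (B *\<^sub>v y) = y \<bullet> (B\<^sup>T *\<^sub>v u)"
    by (simp only: B(2) Bu)
  also have "\<dots> = (B *\<^sub>v y) \<bullet> u"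
    by (rule scalar_prod_mult_transpose[OF B(1) y u])
  also have "\<dots> = u \<bullet> (B *\<^sub>v u)"
    unfolding Bu using B(1) y u by (intro comm_scalar_prod[of _ N]) auto
  finally show ?thesis
    by (simp only: u_def)
qed

section \<open>Moments of independent families\<close>

text \<open>Factorization in two stages. The product over one block is a measurable function of the
  block vector, hence these products are independent across t; each of them then factors by the
  independence inside its block.\<close>

lemma (in prob_space) indep_blocks_expectation_prod:
  fixes \<alpha> :: "'i \<Rightarrow> 'j \<Rightarrow> 'a \<Rightarrow> real" and g :: "'i \<Rightarrow> 'j \<Rightarrow> real \<Rightarrow> real"
  assumes fin: "finite I" "\<And>t. t \<in> I \<Longrightarrow> finite (J t)"
    and blocks: "indep_vars (\<lambda>t. PiM (J t) (\<lambda>_. borel)) (\<lambda>t \<omega>. \<lambda>l\<in>J t. \<alpha> t l \<omega>) I"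
    and within: "\<And>t. t \<in> I \<Longrightarrow> indep_vars (\<lambda>_. borel) (\<alpha> t) (J t)"
    and meas: "\<And>t l. t \<in> I \<Longrightarrow> l \<in> J t \<Longrightarrow> g t l \<in> borel_measurable borel"
    and int: "\<And>t l. t \<in> I \<Longrightarrow> l \<in> J t \<Longrightarrow> integrable M (\<lambda>\<omega>. g t l (\<alpha> t l \<omega>))"
  shows "integrable M (\<lambda>\<omega>. \<Prod>t\<in>I. \<Prod>l\<in>J t. g t l (\<alpha> t l \<omega>))"
    and "expectation (\<lambda>\<omega>. \<Prod>t\<in>I. \<Prod>l\<in>J t. g t l (\<alpha> t l \<omega>)) =
      (\<Prod>t\<in>I. \<Prod>l\<in>J t. expectation (\<lambda>\<omega>. g t l (\<alpha> t l \<omega>)))"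
proof -
  have meas_block: "(\<lambda>v. \<Prod>l\<in>J t. g t l (v l)) \<in> borel_measurable (PiM (J t) (\<lambda>_. borel))"
    if "t \<in> I" for t
  proof (rule borel_measurable_prod)
    fix l assume "l \<in> J t"
    then show "(\<lambda>v. g t l (v l)) \<in> borel_measurable (PiM (J t) (\<lambda>_. borel))"
      by (intro measurable_compose[of "\<lambda>v. v l" _ borel "g t l"] measurable_component_singleton meas that)
  qed
  have "indep_vars (\<lambda>_. borel) (\<lambda>t \<omega>. \<Prod>l\<in>J t. g t l ((\<lambda>l\<in>J t. \<alpha> t l \<omega>) l)) I"
    using indep_vars_compose2[OF blocks meas_block] by simp
  then have outer: "indep_vars (\<lambda>_. borel) (\<lambda>t \<omega>. \<Prod>l\<in>J t. g t l (\<alpha> t l \<omega>)) I"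
    by simp
  have inner: "indep_vars (\<lambda>_. borel) (\<lambda>l \<omega>. g t l (\<alpha> t l \<omega>)) (J t)" if "t \<in> I" for t
    using that by (intro indep_vars_compose2[OF within, where Y = "g t"] meas)
  have int_inner: "integrable M (\<lambda>\<omega>. \<Prod>l\<in>J t. g t l (\<alpha> t l \<omega>))" if "t \<in> I" for t
    using indep_vars_integrable[OF fin(2)[OF that] inner[OF that] int[OF that]] .
  show "integrable M (\<lambda>\<omega>. \<Prod>t\<in>I. \<Prod>l\<in>J t. g t l (\<alpha> t l \<omega>))"
    using indep_vars_integrable[OF fin(1) outer int_inner] .
  have "expectation (\<lambda>\<omega>. \<Prod>t\<in>I. \<Prod>l\<in>J t. g t l (\<alpha> t l \<omega>)) =
      (\<Prod>t\<in>I. expectation (\<lambda>\<omega>. \<Prod>l\<in>J t. g t l (\<alpha> t l \<omega>)))"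
    using indep_vars_lebesgue_integral[OF fin(1) outer int_inner] .
  also have "\<dots> = (\<Prod>t\<in>I. \<Prod>l\<in>J t. expectation (\<lambda>\<omega>. g t l (\<alpha> t l \<omega>)))"
    by (intro prod.cong refl indep_vars_lebesgue_integral fin inner int)
  finally show "expectation (\<lambda>\<omega>. \<Prod>t\<in>I. \<Prod>l\<in>J t. g t l (\<alpha> t l \<omega>)) =
      (\<Prod>t\<in>I. \<Prod>l\<in>J t. expectation (\<lambda>\<omega>. g t l (\<alpha> t l \<omega>)))" .
qed

text \<open>On a probability space the bound |x|^e \<le> 1 + x^4 suffices.\<close>

lemma (in prob_space) integrable_power_le_4:
  fixes X :: "'a \<Rightarrow> real"
  assumes [measurable]: "X \<in> borel_measurable M" and int: "integrable M (\<lambda>\<omega>. X \<omega> ^ 4)" and "e \<le> 4"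
  shows "integrable M (\<lambda>\<omega>. X \<omega> ^ e)"
proof (rule Bochner_Integration.integrable_bound)
  show "integrable M (\<lambda>\<omega>. 1 + X \<omega> ^ 4)"
    using int by simp
  have "\<bar>x\<bar> ^ e \<le> 1 + \<bar>x\<bar> ^ 4" for x :: real
  proof (cases "\<bar>x\<bar> \<le> 1")
    case True
    then have "\<bar>x\<bar> ^ e \<le> 1"
      by (simp add: power_le_one)
    then show ?thesis
      by (smt (verit) zero_le_power abs_ge_zero)
  next
    case False
    then have "\<bar>x\<bar> ^ e \<le> \<bar>x\<bar> ^ 4"
      using \<open>e \<le> 4\<close> by (intro power_increasing) auto
    then show ?thesis
      by simp
  qed
  then show "AE \<omega> in M. norm (X \<omega> ^ e) \<le> norm (1 + X \<omega> ^ 4)"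
    by (auto simp: power_abs)
qed simp

text \<open>Keeps of independence only the factorization of mixed moments with exponents up to 4, so that the
  blockwise independence of the model need not be turned into joint independence of all components.\<close>

definition moment_family :: "'a measure \<Rightarrow> 'k set \<Rightarrow> ('k \<Rightarrow> 'a \<Rightarrow> real) \<Rightarrow> bool" where
  "moment_family M K \<xi> \<longleftrightarrow> finite K \<and> (\<forall>a\<in>K. (\<integral>\<omega>. \<xi> a \<omega> \<partial>M) = 0) \<and>
     (\<forall>e. (\<forall>a\<in>K. e a \<le> 4) \<longrightarrow> integrable M (\<lambda>\<omega>. \<Prod>a\<in>K. \<xi> a \<omega> ^ e a) \<and>
        (\<integral>\<omega>. (\<Prod>a\<in>K. \<xi> a \<omega> ^ e a) \<partial>M) = (\<Prod>a\<in>K. \<integral>\<omega>. \<xi> a \<omega> ^ e a \<partial>M))"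

lemma prod_power_of_bool:
  fixes x :: "'k \<Rightarrow> real"
  assumes "finite K" "a \<in> K"
  shows "(\<Prod>k\<in>K. x k ^ of_bool (k = a)) = x a"
proof -
  have "(\<Prod>k\<in>K. x k ^ of_bool (k = a)) = (\<Prod>k\<in>K. if k = a then x k else 1)"
    by (intro prod.cong) auto
  then show ?thesis
    using assms by simp
qed

text \<open>An index occurring exactly once contributes a zero mean, so only two pairs or four equal
  indices survive. If all four agree, the three pairings already give 3 v^2, and \<kappa> is what
  remains of the fourth moment.\<close>

lemma (in prob_space) moment_family_fourth:
  fixes \<xi> :: "'k \<Rightarrow> 'a \<Rightarrow> real"
  assumes fam: "moment_family M K \<xi>" and abcd: "a \<in> K" "b \<in> K" "c \<in> K" "d \<in> K"
  defines "v \<equiv> \<lambda>a. expectation (\<lambda>\<omega>. \<xi> a \<omega> ^ 2)"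
  defines "\<kappa> \<equiv> \<lambda>a. expectation (\<lambda>\<omega>. \<xi> a \<omega> ^ 4) - 3 * (v a)\<^sup>2"
  shows "integrable M (\<lambda>\<omega>. \<xi> a \<omega> * \<xi> b \<omega> * \<xi> c \<omega> * \<xi> d \<omega>)"
    and "expectation (\<lambda>\<omega>. \<xi> a \<omega> * \<xi> b \<omega> * \<xi> c \<omega> * \<xi> d \<omega>) =
      of_bool (a = b) * of_bool (c = d) * v a * v c +
      of_bool (a = c) * of_bool (b = d) * v a * v b +
      of_bool (a = d) * of_bool (b = c) * v a * v b +
      of_bool (a = b) * of_bool (a = c) * of_bool (a = d) * \<kappa> a"
proof -
  \<comment> \<open>The multiplicity of k among a, b, c, d turns the monomial into a product of
    powers over all of K, the form in which \<open>moment_family\<close> factors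
    expectations.\<close>
  define e where
    "e k = of_bool (k = a) + of_bool (k = b) + of_bool (k = c) + (of_bool (k = d) :: nat)" for k
  define \<mu> where "\<mu> k n = expectation (\<lambda>\<omega>. \<xi> k \<omega> ^ n)" for k n
  have K: "finite K" and e4: "\<forall>k\<in>K. e k \<le> 4"
    using fam by (auto simp: moment_family_def e_def)
  have prod: "(\<lambda>\<omega>. \<Prod>k\<in>K. \<xi> k \<omega> ^ e k) = (\<lambda>\<omega>. \<xi> a \<omega> * \<xi> b \<omega> * \<xi> c \<omega> * \<xi> d \<omega>)"
    unfolding e_def power_add prod.distrib using K abcd by (simp add: prod_power_of_bool)
  have int: "integrable M (\<lambda>\<omega>. \<Prod>k\<in>K. \<xi> k \<omega> ^ e k)"
    and E: "expectation (\<lambda>\<omega>. \<Prod>k\<in>K. \<xi> k \<omega> ^ e k) = (\<Prod>k\<in>K. \<mu> k (e k))"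
    using fam e4 unfolding moment_family_def \<mu>_def by blast+
  show "integrable M (\<lambda>\<omega>. \<xi> a \<omega> * \<xi> b \<omega> * \<xi> c \<omega> * \<xi> d \<omega>)"
    using int unfolding prod .
  have \<mu>: "\<mu> k 0 = 1" "\<mu> k 2 = v k" "\<mu> k 4 = \<kappa> k + 3 * (v k)\<^sup>2" for k
    by (simp_all add: \<mu>_def v_def \<kappa>_def prob_space)
  \<comment> \<open>Evaluating \<open>e\<close> yields sums of ones, which simplification leaves in
    successor form.\<close>
  then have \<mu>_Suc: "\<mu> k (Suc (Suc 0)) = v k" "\<mu> k (Suc (Suc (Suc (Suc 0)))) = \<kappa> k + 3 * (v k)\<^sup>2" for k
    by (simp_all add: eval_nat_numeral)
  have \<mu>1: "k \<in> K \<Longrightarrow> \<mu> k 1 = 0" for k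
    using fam by (simp add: \<mu>_def moment_family_def)
  \<comment> \<open>All other indices have exponent 0 and moment 1. What is left is decided by which
    of a, b, c, d coincide.\<close>
  have "(\<Prod>k\<in>K. \<mu> k (e k)) = (\<Prod>k\<in>{a, b, c, d}. \<mu> k (e k))"
    using K abcd by (intro prod.mono_neutral_right) (auto simp: e_def \<mu>)
  also have "\<dots> =
      of_bool (a = b) * of_bool (c = d) * v a * v c +
      of_bool (a = c) * of_bool (b = d) * v a * v b +
      of_bool (a = d) * of_bool (b = c) * v a * v b +
      of_bool (a = b) * of_bool (a = c) * of_bool (a = d) * \<kappa> a"
    using \<mu>(1) \<mu>_Suc \<mu>1[OF abcd(1)] \<mu>1[OF abcd(2)] \<mu>1[OF abcd(3)] \<mu>1[OF abcd(4)]
    unfolding e_def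
    by (cases "a = b"; cases "a = c"; cases "a = d"; cases "b = c"; cases "b = d"; cases "c = d")
      (simp_all add: power2_eq_square insert_commute)
  finally show "expectation (\<lambda>\<omega>. \<xi> a \<omega> * \<xi> b \<omega> * \<xi> c \<omega> * \<xi> d \<omega>) =
      of_bool (a = b) * of_bool (c = d) * v a * v c +
      of_bool (a = c) * of_bool (b = d) * v a * v b +
      of_bool (a = d) * of_bool (b = c) * v a * v b +
      of_bool (a = b) * of_bool (a = c) * of_bool (a = d) * \<kappa> a"
    using E unfolding prod by simp
qed

lemma (in prob_space) moment_family_second:
  fixes \<xi> :: "'k \<Rightarrow> 'a \<Rightarrow> real"
  assumes fam: "moment_family M K \<xi>" and ab: "a \<in> K" "b \<in> K"
  shows "integrable M (\<lambda>\<omega>. \<xi> a \<omega> * \<xi> b \<omega>)"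
    and "expectation (\<lambda>\<omega>. \<xi> a \<omega> * \<xi> b \<omega>) = of_bool (a = b) * expectation (\<lambda>\<omega>. \<xi> a \<omega> ^ 2)"
proof -
  define e where "e k = of_bool (k = a) + (of_bool (k = b) :: nat)" for k
  define \<mu> where "\<mu> k n = expectation (\<lambda>\<omega>. \<xi> k \<omega> ^ n)" for k n
  have K: "finite K" and e4: "\<forall>k\<in>K. e k \<le> 4"
    using fam by (auto simp: moment_family_def e_def)
  have prod: "(\<lambda>\<omega>. \<Prod>k\<in>K. \<xi> k \<omega> ^ e k) = (\<lambda>\<omega>. \<xi> a \<omega> * \<xi> b \<omega>)"
    unfolding e_def power_add prod.distrib using K ab by (simp add: prod_power_of_bool)
  have int: "integrable M (\<lambda>\<omega>. \<Prod>k\<in>K. \<xi> k \<omega> ^ e k)"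
    and E: "expectation (\<lambda>\<omega>. \<Prod>k\<in>K. \<xi> k \<omega> ^ e k) = (\<Prod>k\<in>K. \<mu> k (e k))"
    using fam e4 unfolding moment_family_def \<mu>_def by blast+
  show "integrable M (\<lambda>\<omega>. \<xi> a \<omega> * \<xi> b \<omega>)"
    using int unfolding prod .
  have \<mu>: "\<mu> k 0 = 1" for k
    by (simp add: \<mu>_def prob_space)
  have \<mu>1: "k \<in> K \<Longrightarrow> \<mu> k 1 = 0" for k
    using fam by (simp add: \<mu>_def moment_family_def)
  have "(\<Prod>k\<in>K. \<mu> k (e k)) = (\<Prod>k\<in>{a, b}. \<mu> k (e k))"
    using K ab by (intro prod.mono_neutral_right) (auto simp: e_def \<mu>)
  also have "\<dots> = of_bool (a = b) * \<mu> a 2"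
    using \<mu> \<mu>1[OF ab(1)] \<mu>1[OF ab(2)] unfolding e_def
    by (cases "a = b") (simp_all add: numeral_2_eq_2)
  finally show "expectation (\<lambda>\<omega>. \<xi> a \<omega> * \<xi> b \<omega>) = of_bool (a = b) * expectation (\<lambda>\<omega>. \<xi> a \<omega> ^ 2)"
    using E unfolding prod by (simp add: \<mu>_def)
qed

lemma sum_delta_pairs:
  fixes p q v :: "'k \<Rightarrow> real"
  assumes "finite K"
  shows "(\<Sum>a\<in>K. \<Sum>b\<in>K. p a * q b * (of_bool (a = b) * v a)) = (\<Sum>a\<in>K. p a * q a * v a)"
proof (intro sum.cong refl)
  fix a assume "a \<in> K"
  have "(\<Sum>b\<in>K. p a * q b * (of_bool (a = b) * v a)) = (\<Sum>b\<in>K. if a = b then p a * q b * v a else 0)"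
    by (intro sum.cong) auto
  then show "(\<Sum>b\<in>K. p a * q b * (of_bool (a = b) * v a)) = p a * q a * v a"
    using assms \<open>a \<in> K\<close> by simp
qed

lemma (in prob_space) linear_forms_second:
  fixes \<xi> :: "'k \<Rightarrow> 'a \<Rightarrow> real"
  assumes fam: "moment_family M K \<xi>"
  shows "integrable M (\<lambda>\<omega>. (\<Sum>a\<in>K. p a * \<xi> a \<omega>) * (\<Sum>a\<in>K. q a * \<xi> a \<omega>))"
    and "expectation (\<lambda>\<omega>. (\<Sum>a\<in>K. p a * \<xi> a \<omega>) * (\<Sum>a\<in>K. q a * \<xi> a \<omega>)) =
      (\<Sum>a\<in>K. p a * q a * expectation (\<lambda>\<omega>. \<xi> a \<omega> ^ 2))"
proof -
  have K: "finite K"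
    using fam by (simp add: moment_family_def)
  have eq: "(\<lambda>\<omega>. (\<Sum>a\<in>K. p a * \<xi> a \<omega>) * (\<Sum>a\<in>K. q a * \<xi> a \<omega>)) =
      (\<lambda>\<omega>. \<Sum>a\<in>K. \<Sum>b\<in>K. p a * q b * (\<xi> a \<omega> * \<xi> b \<omega>))"
    by (simp add: sum_product mult_ac)
  note 2 = moment_family_second[OF fam]
  show "integrable M (\<lambda>\<omega>. (\<Sum>a\<in>K. p a * \<xi> a \<omega>) * (\<Sum>a\<in>K. q a * \<xi> a \<omega>))"
    unfolding eq by (intro Bochner_Integration.integrable_sum integrable_mult_right 2)
  have "expectation (\<lambda>\<omega>. \<Sum>a\<in>K. \<Sum>b\<in>K. p a * q b * (\<xi> a \<omega> * \<xi> b \<omega>)) =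
      (\<Sum>a\<in>K. \<Sum>b\<in>K. p a * q b * expectation (\<lambda>\<omega>. \<xi> a \<omega> * \<xi> b \<omega>))"
    by (simp add: Bochner_Integration.integral_sum Bochner_Integration.integrable_sum 2(1))
  also have "\<dots> = (\<Sum>a\<in>K. \<Sum>b\<in>K. p a * q b * (of_bool (a = b) * expectation (\<lambda>\<omega>. \<xi> a \<omega> ^ 2)))"
    by (intro sum.cong refl) (simp add: 2(2))
  also have "\<dots> = (\<Sum>a\<in>K. p a * q a * expectation (\<lambda>\<omega>. \<xi> a \<omega> ^ 2))"
    by (rule sum_delta_pairs[OF K])
  finally show "expectation (\<lambda>\<omega>. (\<Sum>a\<in>K. p a * \<xi> a \<omega>) * (\<Sum>a\<in>K. q a * \<xi> a \<omega>)) =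
      (\<Sum>a\<in>K. p a * q a * expectation (\<lambda>\<omega>. \<xi> a \<omega> ^ 2))"
    unfolding eq .
qed

lemma sum4_delta_pairs:
  fixes p q r s v :: "'k \<Rightarrow> real"
  assumes "finite K"
  shows "(\<Sum>a\<in>K. \<Sum>b\<in>K. \<Sum>c\<in>K. \<Sum>d\<in>K. p a * q b * r c * s d *
      (of_bool (a = b) * of_bool (c = d) * v a * v c)) =
      (\<Sum>a\<in>K. p a * q a * v a) * (\<Sum>c\<in>K. r c * s c * v c)" (is "?L = _")
proof -
  have "?L = (\<Sum>a\<in>K. \<Sum>b\<in>K. \<Sum>c\<in>K. \<Sum>d\<in>K. (p a * q b * (of_bool (a = b) * v a)) *
      (r c * s d * (of_bool (c = d) * v c)))"
    by (intro sum.cong refl) (simp add: mult_ac)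
  also have "\<dots> = (\<Sum>a\<in>K. \<Sum>b\<in>K. p a * q b * (of_bool (a = b) * v a)) *
      (\<Sum>c\<in>K. \<Sum>d\<in>K. r c * s d * (of_bool (c = d) * v c))"
    by (simp only: sum_distrib_left[symmetric] sum_distrib_right[symmetric])
  finally show ?thesis
    unfolding sum_delta_pairs[OF assms] .
qed

text \<open>Multilinear expansion of the four forms, followed by collapsing the Kronecker deltas of
  \<open>moment_family_fourth\<close>: each pairing splits into a product of two second moments, the
  last term into a single sum.\<close>

lemma (in prob_space) linear_forms_fourth:
  fixes \<xi> :: "'k \<Rightarrow> 'a \<Rightarrow> real"
  assumes fam: "moment_family M K \<xi>"
  defines "v \<equiv> \<lambda>a. expectation (\<lambda>\<omega>. \<xi> a \<omega> ^ 2)"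
  defines "\<kappa> \<equiv> \<lambda>a. expectation (\<lambda>\<omega>. \<xi> a \<omega> ^ 4) - 3 * (v a)\<^sup>2"
  defines "lf \<equiv> \<lambda>p \<omega>. \<Sum>a\<in>K. p a * \<xi> a \<omega>"
  defines "G \<equiv> \<lambda>p q. \<Sum>a\<in>K. p a * q a * v a"
  shows "integrable M (\<lambda>\<omega>. lf p \<omega> * lf q \<omega> * lf r \<omega> * lf s \<omega>)"
    and "expectation (\<lambda>\<omega>. lf p \<omega> * lf q \<omega> * lf r \<omega> * lf s \<omega>) =
      G p q * G r s + G p r * G q s + G p s * G q r + (\<Sum>a\<in>K. p a * q a * r a * s a * \<kappa> a)"
proof -
  have K: "finite K"
    using fam by (simp add: moment_family_def)
  have eq: "(\<lambda>\<omega>. lf p \<omega> * lf q \<omega> * lf r \<omega> * lf s \<omega>) =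
      (\<lambda>\<omega>. \<Sum>a\<in>K. \<Sum>b\<in>K. \<Sum>c\<in>K. \<Sum>d\<in>K. p a * q b * r c * s d * (\<xi> a \<omega> * \<xi> b \<omega> * \<xi> c \<omega> * \<xi> d \<omega>))"
  proof
    fix \<omega>
    have "(\<Sum>a\<in>K. \<Sum>b\<in>K. \<Sum>c\<in>K. \<Sum>d\<in>K. p a * q b * r c * s d * (\<xi> a \<omega> * \<xi> b \<omega> * \<xi> c \<omega> * \<xi> d \<omega>)) =
        (\<Sum>a\<in>K. \<Sum>b\<in>K. \<Sum>c\<in>K. \<Sum>d\<in>K. (p a * \<xi> a \<omega>) * ((q b * \<xi> b \<omega>) * ((r c * \<xi> c \<omega>) * (s d * \<xi> d \<omega>))))"
      by (simp only: mult_ac)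
    also have "\<dots> = lf p \<omega> * (lf q \<omega> * (lf r \<omega> * lf s \<omega>))"
      by (simp only: sum_distrib_left[symmetric] sum_distrib_right[symmetric] lf_def)
    finally show "lf p \<omega> * lf q \<omega> * lf r \<omega> * lf s \<omega> = (\<Sum>a\<in>K. \<Sum>b\<in>K. \<Sum>c\<in>K. \<Sum>d\<in>K.
        p a * q b * r c * s d * (\<xi> a \<omega> * \<xi> b \<omega> * \<xi> c \<omega> * \<xi> d \<omega>))"
      by (simp add: mult.assoc)
  qed
  note 4 = moment_family_fourth[OF fam]
  show "integrable M (\<lambda>\<omega>. lf p \<omega> * lf q \<omega> * lf r \<omega> * lf s \<omega>)"
    unfolding eq by (intro Bochner_Integration.integrable_sum integrable_mult_right 4)
  have "expectation (\<lambda>\<omega>. lf p \<omega> * lf q \<omega> * lf r \<omega> * lf s \<omega>) =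
      (\<Sum>a\<in>K. \<Sum>b\<in>K. \<Sum>c\<in>K. \<Sum>d\<in>K. p a * q b * r c * s d *
        expectation (\<lambda>\<omega>. \<xi> a \<omega> * \<xi> b \<omega> * \<xi> c \<omega> * \<xi> d \<omega>))"
    unfolding eq
    by (simp add: Bochner_Integration.integral_sum Bochner_Integration.integrable_sum 4(1))
  also have "\<dots> = (\<Sum>a\<in>K. \<Sum>b\<in>K. \<Sum>c\<in>K. \<Sum>d\<in>K.
      p a * q b * r c * s d * (of_bool (a = b) * of_bool (c = d) * v a * v c) +
      p a * q b * r c * s d * (of_bool (a = c) * of_bool (b = d) * v a * v b) +
      p a * q b * r c * s d * (of_bool (a = d) * of_bool (b = c) * v a * v b) +
      p a * q b * r c * s d * (of_bool (a = b) * of_bool (a = c) * of_bool (a = d) * \<kappa> a))"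
    by (intro sum.cong refl) (simp add: 4(2) v_def \<kappa>_def distrib_left)
  also have "\<dots> =
      (\<Sum>a\<in>K. \<Sum>b\<in>K. \<Sum>c\<in>K. \<Sum>d\<in>K. p a * q b * r c * s d * (of_bool (a = b) * of_bool (c = d) * v a * v c)) +
      (\<Sum>a\<in>K. \<Sum>b\<in>K. \<Sum>c\<in>K. \<Sum>d\<in>K. p a * q b * r c * s d * (of_bool (a = c) * of_bool (b = d) * v a * v b)) +
      (\<Sum>a\<in>K. \<Sum>b\<in>K. \<Sum>c\<in>K. \<Sum>d\<in>K. p a * q b * r c * s d * (of_bool (a = d) * of_bool (b = c) * v a * v b)) +
      (\<Sum>a\<in>K. \<Sum>b\<in>K. \<Sum>c\<in>K. \<Sum>d\<in>K. p a * q b * r c * s d * (of_bool (a = b) * of_bool (a = c) * of_bool (a = d) * \<kappa> a))"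
    by (simp only: sum.distrib)
  also have "(\<Sum>a\<in>K. \<Sum>b\<in>K. \<Sum>c\<in>K. \<Sum>d\<in>K. p a * q b * r c * s d * (of_bool (a = b) * of_bool (c = d) * v a * v c))
      = G p q * G r s"
    unfolding G_def by (rule sum4_delta_pairs[OF K])
  \<comment> \<open>The two remaining pairings reduce to the first one by reordering the summations
    until paired indices are adjacent.\<close>
  also have "(\<Sum>a\<in>K. \<Sum>b\<in>K. \<Sum>c\<in>K. \<Sum>d\<in>K. p a * q b * r c * s d * (of_bool (a = c) * of_bool (b = d) * v a * v b))
      = G p r * G q s"
    unfolding G_def sum4_delta_pairs[OF K, symmetric]
    by (subst (2) sum.swap) (intro sum.cong refl, simp add: mult_ac)
  also have "(\<Sum>a\<in>K. \<Sum>b\<in>K. \<Sum>c\<in>K. \<Sum>d\<in>K. p a * q b * r c * s d * (of_bool (a = d) * of_bool (b = c) * v a * v b))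
      = (\<Sum>a\<in>K. \<Sum>d\<in>K. \<Sum>b\<in>K. \<Sum>c\<in>K. p a * q b * r c * s d * (of_bool (a = d) * of_bool (b = c) * v a * v b))"
    by (subst (2) sum.swap, subst (3) sum.swap) simp
  also have "\<dots> = G p s * G q r"
    unfolding G_def sum4_delta_pairs[OF K, symmetric]
    by (intro sum.cong refl) (simp add: mult_ac)
  also have "(\<Sum>a\<in>K. \<Sum>b\<in>K. \<Sum>c\<in>K. \<Sum>d\<in>K. p a * q b * r c * s d * (of_bool (a = b) * of_bool (a = c) * of_bool (a = d) * \<kappa> a))
      = (\<Sum>a\<in>K. p a * q a * r a * s a * \<kappa> a)"
  proof (intro sum.cong refl)
    fix a assume a: "a \<in> K"
    have 1: "(\<Sum>b\<in>K. of_bool (a = b) * g b) = g a" for g :: "'k \<Rightarrow> real"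
      using K a by (simp add: of_bool_def if_distrib[of "\<lambda>x. x * _"] cong: if_cong)
    have "(\<Sum>b\<in>K. \<Sum>c\<in>K. \<Sum>d\<in>K. p a * q b * r c * s d * (of_bool (a = b) * of_bool (a = c) * of_bool (a = d) * \<kappa> a)) =
      (\<Sum>b\<in>K. of_bool (a = b) * (\<Sum>c\<in>K. of_bool (a = c) * (\<Sum>d\<in>K. of_bool (a = d) * (p a * q b * r c * s d * \<kappa> a))))"
      by (simp only: sum_distrib_left mult_ac)
    then show "(\<Sum>b\<in>K. \<Sum>c\<in>K. \<Sum>d\<in>K. p a * q b * r c * s d * (of_bool (a = b) * of_bool (a = c) * of_bool (a = d) * \<kappa> a))
      = p a * q a * r a * s a * \<kappa> a"
      by (simp only: 1)
  qed
  finally show "expectation (\<lambda>\<omega>. lf p \<omega> * lf q \<omega> * lf r \<omega> * lf s \<omega>) =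
      G p q * G r s + G p r * G q s + G p s * G q r + (\<Sum>a\<in>K. p a * q a * r a * s a * \<kappa> a)" .
qed

section \<open>Covariance of quadratic forms\<close>

lemma (in prob_space) covariance_shift:
  assumes "integrable M S" "integrable M T" "integrable M (\<lambda>\<omega>. S \<omega> * T \<omega>)"
  shows "covariance M (\<lambda>\<omega>. a + S \<omega>) (\<lambda>\<omega>. b + T \<omega>) =
    expectation (\<lambda>\<omega>. S \<omega> * T \<omega>) - expectation S * expectation T"
proof -
  have "covariance M (\<lambda>\<omega>. a + S \<omega>) (\<lambda>\<omega>. b + T \<omega>) =
      expectation (\<lambda>\<omega>. (S \<omega> - expectation S) * (T \<omega> - expectation T))"
    using assms by (simp add: covariance_def prob_space)
  also have "(\<lambda>\<omega>. (S \<omega> - expectation S) * (T \<omega> - expectation T)) =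
      (\<lambda>\<omega>. S \<omega> * T \<omega> - expectation T * S \<omega> - expectation S * T \<omega> + expectation S * expectation T)"
    by (simp add: algebra_simps)
  also have "expectation \<dots> = expectation (\<lambda>\<omega>. S \<omega> * T \<omega>) - expectation S * expectation T"
    using assms by (simp add: prob_space)
  finally show ?thesis .
qed

lemma sum_product_quad:
  fixes a b :: "nat \<Rightarrow> nat \<Rightarrow> real"
  shows "(\<Sum>i<N. \<Sum>j<N. a i j) * (\<Sum>k<N. \<Sum>l<N. b k l) = (\<Sum>i<N. \<Sum>j<N. \<Sum>k<N. \<Sum>l<N. a i j * b k l)"
  by (simp only: sum_distrib_right) (simp only: sum_distrib_left)

text \<open>A and B are arbitrary coefficient arrays, so the two cross pairings appear separately;
  symmetry merges them later. The product of the two means is precisely the pairing that the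
  subtraction removes.\<close>

lemma (in prob_space) covariance_quad_forms:
  fixes \<xi> :: "'k \<Rightarrow> 'a \<Rightarrow> real" and z :: "nat \<Rightarrow> 'k \<Rightarrow> real"
  assumes fam: "moment_family M K \<xi>"
  defines "v \<equiv> \<lambda>a. expectation (\<lambda>\<omega>. \<xi> a \<omega> ^ 2)"
  defines "\<kappa> \<equiv> \<lambda>a. expectation (\<lambda>\<omega>. \<xi> a \<omega> ^ 4) - 3 * (v a)\<^sup>2"
  defines "u \<equiv> \<lambda>i \<omega>. \<Sum>a\<in>K. z i a * \<xi> a \<omega>"
  defines "G \<equiv> \<lambda>i j. \<Sum>a\<in>K. z i a * z j a * v a"
  shows "covariance M (\<lambda>\<omega>. a + (\<Sum>i<N. \<Sum>j<N. A i j * (u i \<omega> * u j \<omega>)))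
      (\<lambda>\<omega>. b + (\<Sum>i<N. \<Sum>j<N. B i j * (u i \<omega> * u j \<omega>))) =
    (\<Sum>i<N. \<Sum>j<N. \<Sum>k<N. \<Sum>l<N. A i j * B k l *
      (G i k * G j l + G i l * G j k + (\<Sum>a\<in>K. z i a * z j a * z k a * z l a * \<kappa> a)))"
proof -
  note two = linear_forms_second[OF fam]
  note four = linear_forms_fourth[OF fam]
  define Q where "Q A \<omega> = (\<Sum>i<N. \<Sum>j<N. A i j * (u i \<omega> * u j \<omega>))" for A \<omega>
  have int2: "integrable M (\<lambda>\<omega>. u i \<omega> * u j \<omega>)" for i j
    unfolding u_def by (rule two)
  have E2: "expectation (\<lambda>\<omega>. u i \<omega> * u j \<omega>) = G i j" for i j
    unfolding u_def G_def v_def by (rule two)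
  have int4: "integrable M (\<lambda>\<omega>. u i \<omega> * u j \<omega> * u k \<omega> * u l \<omega>)" for i j k l
    unfolding u_def by (rule four)
  have E4: "expectation (\<lambda>\<omega>. u i \<omega> * u j \<omega> * u k \<omega> * u l \<omega>) =
      G i j * G k l + G i k * G j l + G i l * G j k + (\<Sum>a\<in>K. z i a * z j a * z k a * z l a * \<kappa> a)" for i j k l
    unfolding u_def G_def v_def \<kappa>_def by (rule four)
  have intQ: "integrable M (Q A)" for A
    unfolding Q_def by (intro Bochner_Integration.integrable_sum integrable_mult_right int2)
  have EQ: "expectation (Q A) = (\<Sum>i<N. \<Sum>j<N. A i j * G i j)" for A
    unfolding Q_def
    by (simp add: Bochner_Integration.integral_sum Bochner_Integration.integrable_sum int2 E2)
  have QQ: "(\<lambda>\<omega>. Q A \<omega> * Q B \<omega>) =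
      (\<lambda>\<omega>. \<Sum>i<N. \<Sum>j<N. \<Sum>k<N. \<Sum>l<N. A i j * B k l * (u i \<omega> * u j \<omega> * u k \<omega> * u l \<omega>))"
    unfolding Q_def sum_product_quad by (simp only: mult_ac)
  have intQQ: "integrable M (\<lambda>\<omega>. Q A \<omega> * Q B \<omega>)"
    unfolding QQ by (intro Bochner_Integration.integrable_sum integrable_mult_right int4)
  have EQQ: "expectation (\<lambda>\<omega>. Q A \<omega> * Q B \<omega>) = (\<Sum>i<N. \<Sum>j<N. \<Sum>k<N. \<Sum>l<N. A i j * B k l *
      (G i j * G k l + G i k * G j l + G i l * G j k + (\<Sum>a\<in>K. z i a * z j a * z k a * z l a * \<kappa> a)))"
    unfolding QQ
    by (simp add: Bochner_Integration.integral_sum Bochner_Integration.integrable_sum int4 E4)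
  have "covariance M (\<lambda>\<omega>. a + Q A \<omega>) (\<lambda>\<omega>. b + Q B \<omega>) =
      expectation (\<lambda>\<omega>. Q A \<omega> * Q B \<omega>) - expectation (Q A) * expectation (Q B)"
    by (rule covariance_shift[OF intQ intQ intQQ])
  also have "\<dots> = (\<Sum>i<N. \<Sum>j<N. \<Sum>k<N. \<Sum>l<N.
      A i j * B k l * (G i j * G k l + G i k * G j l + G i l * G j k + (\<Sum>a\<in>K. z i a * z j a * z k a * z l a * \<kappa> a))
      - (A i j * G i j) * (B k l * G k l))"
    unfolding EQQ EQ sum_product_quad by (simp only: sum_subtractf)
  also have "\<dots> = (\<Sum>i<N. \<Sum>j<N. \<Sum>k<N. \<Sum>l<N. A i j * B k l *
      (G i k * G j l + G i l * G j k + (\<Sum>a\<in>K. z i a * z j a * z k a * z l a * \<kappa> a)))"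
    by (intro sum.cong refl) (simp add: distrib_left mult_ac)
  finally show ?thesis
    by (simp only: Q_def)
qed

text \<open>The components are indexed by pairs (t, l), and the two-stage factorization is applied
  to the powers \<open>x ^ e (t, l)\<close>, which are integrable thanks to the fourth
  moments.\<close>

lemma moment_family_blocks:
  fixes \<alpha> :: "nat \<Rightarrow> nat \<Rightarrow> 'a \<Rightarrow> real"
  assumes "prob_space M"
    and blocks: "prob_space.indep_vars M (\<lambda>t. PiM {..<m t} (\<lambda>_. borel))
           (\<lambda>t \<omega>. \<lambda>l\<in>{..<m t}. \<alpha> t l \<omega>) {..s}"
    and within: "\<And>t. t \<le> s \<Longrightarrow> prob_space.indep_vars M (\<lambda>_. borel) (\<alpha> t) {..<m t}"
    and int: "\<And>t l. t \<le> s \<Longrightarrow> l < m t \<Longrightarrow> integrable M (\<lambda>\<omega>. \<alpha> t l \<omega> ^ 4)"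
    and zero: "\<And>t l. t \<le> s \<Longrightarrow> l < m t \<Longrightarrow> prob_space.expectation M (\<alpha> t l) = 0"
  shows "moment_family M (SIGMA t:{..s}. {..<m t}) (\<lambda>(t, l). \<alpha> t l)"
  unfolding moment_family_def
proof (intro conjI ballI allI impI)
  interpret prob_space M by fact
  show "finite (SIGMA t:{..s}. {..<m t})"
    by simp
  show "(\<integral>\<omega>. (case a of (t, l) \<Rightarrow> \<alpha> t l) \<omega> \<partial>M) = 0" if "a \<in> (SIGMA t:{..s}. {..<m t})" for a
    using that zero by auto
  fix e :: "nat \<times> nat \<Rightarrow> nat" assume e: "\<forall>a\<in>(SIGMA t:{..s}. {..<m t}). e a \<le> 4"
  have meas: "\<alpha> t l \<in> borel_measurable M" if "t \<le> s" "l < m t" for t l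
    using within[OF that(1)] that(2) by (auto simp: indep_vars_def)
  have int': "integrable M (\<lambda>\<omega>. \<alpha> t l \<omega> ^ e (t, l))" if "t \<in> {..s}" "l \<in> {..<m t}" for t l
    using that e by (intro integrable_power_le_4[OF meas int]) auto
  have nest: "(\<Prod>a\<in>(SIGMA t:{..s}. {..<m t}). g a) = (\<Prod>t\<le>s. \<Prod>l<m t. g (t, l))" for g :: "nat \<times> nat \<Rightarrow> real"
    by (subst prod.Sigma) auto
  have "integrable M (\<lambda>\<omega>. \<Prod>t\<le>s. \<Prod>l<m t. \<alpha> t l \<omega> ^ e (t, l))"
    by (rule indep_blocks_expectation_prod(1)[OF _ _ blocks, where g = "\<lambda>t l x. x ^ e (t, l)"])
      (use within int' in auto)
  then show "integrable M (\<lambda>\<omega>. \<Prod>a\<in>(SIGMA t:{..s}. {..<m t}). (case a of (t, l) \<Rightarrow> \<alpha> t l) \<omega> ^ e a)"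
    unfolding nest prod.case .
  have "(\<integral>\<omega>. (\<Prod>t\<le>s. \<Prod>l<m t. \<alpha> t l \<omega> ^ e (t, l)) \<partial>M) = (\<Prod>t\<le>s. \<Prod>l<m t. \<integral>\<omega>. \<alpha> t l \<omega> ^ e (t, l) \<partial>M)"
    by (rule indep_blocks_expectation_prod(2)[OF _ _ blocks, where g = "\<lambda>t l x. x ^ e (t, l)"])
      (use within int' in auto)
  then show "(\<integral>\<omega>. (\<Prod>a\<in>(SIGMA t:{..s}. {..<m t}). (case a of (t, l) \<Rightarrow> \<alpha> t l) \<omega> ^ e a) \<partial>M) =
      (\<Prod>a\<in>(SIGMA t:{..s}. {..<m t}). \<integral>\<omega>. (case a of (t, l) \<Rightarrow> \<alpha> t l) \<omega> ^ e a \<partial>M)"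
    unfolding nest prod.case .
qed

section \<open>Sums over index quadruples and averaging over level sets of f\<close>

lemma sum_quads: "(\<Sum>q\<in>quads N. g q) = (\<Sum>i<N. \<Sum>j<N. \<Sum>k<N. \<Sum>l<N. g (i, j, k, l))"
  by (simp add: quads_def sum.cartesian_product')

lemma finite_quads: "finite (quads N)"
  by (simp add: quads_def)

text \<open>On a level set \<open>c_val\<close> is the mean of the products a, and h is constant, so
  replacing a by its mean keeps the sum over each level set. The condition P depends on the value of
  f only, which makes the range of summation a union of whole level sets.\<close>

lemma sum_c_val:
  fixes f :: "nat \<times> nat \<times> nat \<times> nat \<Rightarrow> ((nat \<Rightarrow> real) \<Rightarrow> real)" and A B :: "real mat"
  defines "a \<equiv> \<lambda>(i1, i2, i3, i4). A $$ (i1, i2) * B $$ (i3, i4)"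
  shows "(\<Sum>q\<in>{q \<in> quads N. P (f q)}. c_val N f A B (f q) * h (f q)) =
    (\<Sum>q\<in>{q \<in> quads N. P (f q)}. a q * h (f q))"
proof -
  define S where "S = {q \<in> quads N. P (f q)}"
  have S: "finite S"
    using finite_quads by (simp add: S_def)
  have group: "(\<Sum>q\<in>S. g q) = (\<Sum>y\<in>f ` S. \<Sum>q\<in>{q \<in> S. f q = y}. g q)" for g :: "_ \<Rightarrow> real"
    by (rule sum.group[OF S finite_imageI[OF S] order_refl, symmetric])
  have "(\<Sum>q\<in>{q \<in> S. f q = y}. c_val N f A B (f q) * h (f q)) = (\<Sum>q\<in>{q \<in> S. f q = y}. a q * h (f q))"
    if "y \<in> f ` S" for y
  proof -
    define C where "C = {q \<in> quads N. f q = y}"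
    \<comment> \<open>As y is attained in S it satisfies P, so S cuts nothing off its level set. The
      level set is also nonempty, which makes the division in \<open>c_val\<close> genuine.\<close>
    have C: "{q \<in> S. f q = y} = C"
      using that by (auto simp: S_def C_def)
    have "card C \<noteq> 0"
      using that finite_quads by (auto simp: S_def C_def card_eq_0_iff)
    have "(\<Sum>q\<in>C. c_val N f A B (f q) * h (f q)) = (\<Sum>q\<in>C. c_val N f A B y * h y)"
      by (rule sum.cong[OF refl]) (simp add: C_def)
    also have "\<dots> = real (card C) * c_val N f A B y * h y"
      by simp
    also have "real (card C) * c_val N f A B y = (\<Sum>q\<in>C. a q)"
      using \<open>card C \<noteq> 0\<close> unfolding c_val_def C_def[symmetric] a_def[symmetric] by simp
    also have "(\<Sum>q\<in>C. a q) * h y = (\<Sum>q\<in>C. a q * h (f q))"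
      unfolding sum_distrib_right by (rule sum.cong[OF refl]) (simp add: C_def)
    finally show ?thesis
      by (simp only: C)
  qed
  then have "(\<Sum>y\<in>f ` S. \<Sum>q\<in>{q \<in> S. f q = y}. c_val N f A B (f q) * h (f q)) =
      (\<Sum>y\<in>f ` S. \<Sum>q\<in>{q \<in> S. f q = y}. a q * h (f q))"
    by (rule sum.cong[OF refl])
  then show ?thesis
    by (simp only: S_def[symmetric] group[symmetric])
qed

lemma f_fun_swap:
  "f_fun s m Z (i, k, j, l) = f_fun s m Z (i, j, k, l)"
  "f_fun s m Z (i, j, l, k) = f_fun s m Z (i, j, k, l)"
  by (simp_all add: f_fun_def mult_ac)

text \<open>Exchanging two indices leaves f unchanged, hence it permutes the range of summation and
  preserves every weight that is a function of f. These two transpositions carry the pairings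
  (12)(34) and (14)(23) to (13)(24).\<close>

lemma sum_f_fun_swap:
  fixes w :: "((nat \<Rightarrow> real) \<Rightarrow> real) \<Rightarrow> real" and s :: nat and m :: "nat \<Rightarrow> nat" and Z :: "nat \<Rightarrow> real mat"
  defines "f \<equiv> f_fun s m Z"
  shows "(\<Sum>(i, j, k, l)\<in>{q \<in> quads N. P (f q)}. w (f (i, j, k, l)) * g i j k l) =
      (\<Sum>(i, j, k, l)\<in>{q \<in> quads N. P (f q)}. w (f (i, j, k, l)) * g i k j l)"
    and "(\<Sum>(i, j, k, l)\<in>{q \<in> quads N. P (f q)}. w (f (i, j, k, l)) * g i j k l) =
      (\<Sum>(i, j, k, l)\<in>{q \<in> quads N. P (f q)}. w (f (i, j, k, l)) * g i j l k)"
proof -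
  show "(\<Sum>(i, j, k, l)\<in>{q \<in> quads N. P (f q)}. w (f (i, j, k, l)) * g i j k l) =
      (\<Sum>(i, j, k, l)\<in>{q \<in> quads N. P (f q)}. w (f (i, j, k, l)) * g i k j l)"
    by (rule sum.reindex_bij_witness[where
          i = "\<lambda>(i, j, k, l). (i, k, j, l)" and j = "\<lambda>(i, j, k, l). (i, k, j, l)"])
      (auto simp: quads_def f_def f_fun_swap(1))
  show "(\<Sum>(i, j, k, l)\<in>{q \<in> quads N. P (f q)}. w (f (i, j, k, l)) * g i j k l) =
      (\<Sum>(i, j, k, l)\<in>{q \<in> quads N. P (f q)}. w (f (i, j, k, l)) * g i j l k)"
    by (rule sum.reindex_bij_witness[where
          i = "\<lambda>(i, j, k, l). (i, j, l, k)" and j = "\<lambda>(i, j, k, l). (i, j, l, k)"])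
      (auto simp: quads_def f_def f_fun_swap(2))
qed

section \<open>Traces and column sums as sums over index quadruples\<close>

lemma mat_trace_mult4:
  assumes "A \<in> carrier_mat n n" "V \<in> carrier_mat n n" "B \<in> carrier_mat n n"
  shows "mat_trace (A * V * B * V) =
    (\<Sum>i<n. \<Sum>j<n. \<Sum>k<n. \<Sum>l<n. A $$ (i, j) * B $$ (k, l) * (V $$ (j, k) * V $$ (l, i)))"
proof -
  have c: "A * V \<in> carrier_mat n n" "B * V \<in> carrier_mat n n"
    using assms by auto
  have entry: "(C * D) $$ (i, j) = (\<Sum>k<n. C $$ (i, k) * D $$ (k, j))"
    if "C \<in> carrier_mat n n" "D \<in> carrier_mat n n" "i < n" "j < n" for C D :: "real mat" and i j
    using that by (auto simp: scalar_prod_def lessThan_atLeast0)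
  have "mat_trace (A * V * B * V) = (\<Sum>i<n. (A * V * (B * V)) $$ (i, i))"
    using assms c(1) by (simp only: assoc_mult_mat[OF c(1) assms(3,2)] mat_trace_def) simp
  also have "\<dots> = (\<Sum>i<n. \<Sum>k<n. (\<Sum>j<n. A $$ (i, j) * V $$ (j, k)) * (\<Sum>l<n. B $$ (k, l) * V $$ (l, i)))"
    by (intro sum.cong refl) (simp add: entry[OF c] entry[OF assms(1,2)] entry[OF assms(3,2)] del: index_mult_mat)
  also have "\<dots> = (\<Sum>i<n. \<Sum>k<n. \<Sum>j<n. \<Sum>l<n. A $$ (i, j) * B $$ (k, l) * (V $$ (j, k) * V $$ (l, i)))"
    unfolding sum_product by (intro sum.cong refl) (simp add: mult_ac)
  also have "\<dots> = (\<Sum>i<n. \<Sum>j<n. \<Sum>k<n. \<Sum>l<n. A $$ (i, j) * B $$ (k, l) * (V $$ (j, k) * V $$ (l, i)))"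
    by (rule sum.cong[OF refl], rule sum.swap)
  finally show ?thesis .
qed

text \<open>Symmetry of V turns the second pairing into the trace; renaming k and l and using the
  symmetry of B turns the first pairing into the second.\<close>

lemma quad_sum_symmetric:
  assumes "A \<in> carrier_mat n n" "V \<in> carrier_mat n n" "B \<in> carrier_mat n n"
    and sym: "B\<^sup>T = B" "V\<^sup>T = V"
  shows "(\<Sum>i<n. \<Sum>j<n. \<Sum>k<n. \<Sum>l<n. A $$ (i, j) * B $$ (k, l) *
      (V $$ (i, k) * V $$ (j, l) + V $$ (i, l) * V $$ (j, k))) = 2 * mat_trace (A * V * B * V)"
proof -
  have s: "C $$ (i, j) = C $$ (j, i)" if "C \<in> carrier_mat n n" "C\<^sup>T = C" "i < n" "j < n" for C :: "real mat" and i j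
  proof -
    have "C\<^sup>T $$ (i, j) = C $$ (j, i)"
      using that(1,3,4) by simp
    then show ?thesis
      by (simp only: that(2))
  qed
  have 1: "(\<Sum>i<n. \<Sum>j<n. \<Sum>k<n. \<Sum>l<n. A $$ (i, j) * B $$ (k, l) * (V $$ (i, l) * V $$ (j, k))) =
      mat_trace (A * V * B * V)"
    unfolding mat_trace_mult4[OF assms(1-3)]
  proof (intro sum.cong refl)
    fix i j k l assume "i \<in> {..<n}" "l \<in> {..<n}"
    then have "V $$ (i, l) = V $$ (l, i)"
      using s[OF assms(2) sym(2)] by simp
    then show "A $$ (i, j) * B $$ (k, l) * (V $$ (i, l) * V $$ (j, k)) =
        A $$ (i, j) * B $$ (k, l) * (V $$ (j, k) * V $$ (l, i))"
      by simp
  qed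
  have "(\<Sum>i<n. \<Sum>j<n. \<Sum>k<n. \<Sum>l<n. A $$ (i, j) * B $$ (k, l) * (V $$ (i, k) * V $$ (j, l))) =
      (\<Sum>i<n. \<Sum>j<n. \<Sum>k<n. \<Sum>l<n. A $$ (i, j) * B $$ (l, k) * (V $$ (i, l) * V $$ (j, k)))"
    by (rule sum.cong[OF refl], rule sum.cong[OF refl], rule sum.swap)
  also have "\<dots> = (\<Sum>i<n. \<Sum>j<n. \<Sum>k<n. \<Sum>l<n. A $$ (i, j) * B $$ (k, l) * (V $$ (i, l) * V $$ (j, k)))"
  proof (intro sum.cong refl)
    fix i j k l assume "k \<in> {..<n}" "l \<in> {..<n}"
    then have "B $$ (l, k) = B $$ (k, l)"
      using s[OF assms(3) sym(1)] by simp
    then show "A $$ (i, j) * B $$ (l, k) * (V $$ (i, l) * V $$ (j, k)) =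
        A $$ (i, j) * B $$ (k, l) * (V $$ (i, l) * V $$ (j, k))"
      by simp
  qed
  finally show ?thesis
    by (simp only: distrib_left sum.distrib 1 mult_2)
qed

lemma sum_f_fun:
  assumes Z: "\<forall>t\<le>s. Z t \<in> carrier_mat N (m t)"
    and A: "A \<in> carrier_mat N N" and B: "B \<in> carrier_mat N N"
  shows "(\<Sum>i<N. \<Sum>j<N. \<Sum>k<N. \<Sum>l<N. A $$ (i, j) * B $$ (k, l) * f_fun s m Z (i, j, k, l) \<kappa>) =
    (\<Sum>t\<le>s. \<kappa> t * (\<Sum>l<m t. (col (Z t) l \<bullet> (A *\<^sub>v col (Z t) l)) * (col (Z t) l \<bullet> (B *\<^sub>v col (Z t) l))))"
proof -
  have "(\<Sum>t\<le>s. \<kappa> t * (\<Sum>r<m t. (col (Z t) r \<bullet> (A *\<^sub>v col (Z t) r)) * (col (Z t) r \<bullet> (B *\<^sub>v col (Z t) r)))) =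
      (\<Sum>t\<le>s. \<kappa> t * (\<Sum>r<m t. \<Sum>i<N. \<Sum>j<N. \<Sum>k<N. \<Sum>l<N. A $$ (i, j) * B $$ (k, l) *
        (Z t $$ (i, r) * Z t $$ (j, r) * Z t $$ (k, r) * Z t $$ (l, r))))"
  proof (intro sum.cong refl arg_cong2[of _ _ _ _ "(*)"])
    fix t r assume tr: "t \<in> {..s}" "r \<in> {..<m t}"
    then have c: "col (Z t) r \<in> carrier_vec N" "dim_row (Z t) = N" "dim_col (Z t) = m t"
      using Z by auto
    show "(col (Z t) r \<bullet> (A *\<^sub>v col (Z t) r)) * (col (Z t) r \<bullet> (B *\<^sub>v col (Z t) r)) =
      (\<Sum>i<N. \<Sum>j<N. \<Sum>k<N. \<Sum>l<N. A $$ (i, j) * B $$ (k, l) *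
        (Z t $$ (i, r) * Z t $$ (j, r) * Z t $$ (k, r) * Z t $$ (l, r)))"
      unfolding quad_form_sum[OF A c(1)] quad_form_sum[OF B c(1)] sum_product_quad
      using tr c by (intro sum.cong refl) (simp add: mult_ac)
  qed
  \<comment> \<open>Gathering the four index sums into one sum over quadruples lets a single
    interchange move all of them past the sums over r and t.\<close>
  also have "\<dots> = (\<Sum>t\<le>s. \<Sum>r<m t. \<Sum>q\<in>quads N. case q of (i, j, k, l) \<Rightarrow> A $$ (i, j) * B $$ (k, l) *
        (\<kappa> t * (Z t $$ (i, r) * Z t $$ (j, r) * Z t $$ (k, r) * Z t $$ (l, r))))"
    unfolding sum_quads sum_distrib_left by (intro sum.cong refl) (simp add: mult_ac)
  also have "\<dots> = (\<Sum>t\<le>s. \<Sum>q\<in>quads N. \<Sum>r<m t. case q of (i, j, k, l) \<Rightarrow> A $$ (i, j) * B $$ (k, l) *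
        (\<kappa> t * (Z t $$ (i, r) * Z t $$ (j, r) * Z t $$ (k, r) * Z t $$ (l, r))))"
    by (rule sum.cong[OF refl], rule sum.swap)
  also have "\<dots> = (\<Sum>q\<in>quads N. \<Sum>t\<le>s. \<Sum>r<m t. case q of (i, j, k, l) \<Rightarrow> A $$ (i, j) * B $$ (k, l) *
        (\<kappa> t * (Z t $$ (i, r) * Z t $$ (j, r) * Z t $$ (k, r) * Z t $$ (l, r))))"
    by (rule sum.swap)
  also have "\<dots> = (\<Sum>i<N. \<Sum>j<N. \<Sum>k<N. \<Sum>l<N. A $$ (i, j) * B $$ (k, l) * f_fun s m Z (i, j, k, l) \<kappa>)"
    unfolding sum_quads by (simp add: f_fun_def sum_distrib_left)
  finally show ?thesis
    by simp
qed

section \<open>The model in coordinates\<close>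

lemma response_minus_fixed_part:
  assumes "X \<in> carrier_mat N p" "\<beta> \<in> carrier_vec p" "Z 0 = 1\<^sub>m N" "m 0 = N"
    and Z: "\<forall>t\<le>s. Z t \<in> carrier_mat N (m t)" and i: "i < N"
  shows "(response N s m X Z \<beta> \<alpha> \<omega> - X *\<^sub>v \<beta>) $ i =
    (\<Sum>a\<in>(SIGMA t:{..s}. {..<m t}). (case a of (t, l) \<Rightarrow> Z t $$ (i, l)) * (case a of (t, l) \<Rightarrow> \<alpha> t l) \<omega>)"
proof -
  have "X *\<^sub>v \<beta> \<in> carrier_vec N"
    using assms by auto
  then have "(response N s m X Z \<beta> \<alpha> \<omega> - X *\<^sub>v \<beta>) $ i =
      (\<Sum>t=1..s. (Z t *\<^sub>v vec (m t) (\<lambda>l. \<alpha> t l \<omega>)) $ i) + \<alpha> 0 i \<omega>"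
    using i assms(1) by (simp add: response_def del: index_mult_mat_vec)
  also have "(\<Sum>t=1..s. (Z t *\<^sub>v vec (m t) (\<lambda>l. \<alpha> t l \<omega>)) $ i) = (\<Sum>t=1..s. \<Sum>l<m t. Z t $$ (i, l) * \<alpha> t l \<omega>)"
  proof (intro sum.cong refl)
    fix t assume "t \<in> {1..s}"
    then have "Z t \<in> carrier_mat N (m t)"
      using Z by simp
    then show "(Z t *\<^sub>v vec (m t) (\<lambda>l. \<alpha> t l \<omega>)) $ i = (\<Sum>l<m t. Z t $$ (i, l) * \<alpha> t l \<omega>)"
      using i by (auto simp: scalar_prod_def lessThan_atLeast0)
  qed
  \<comment> \<open>Since Z_0 = I, the error component has the same shape as the random effects and
    becomes their missing term t = 0.\<close>
  also have "\<alpha> 0 i \<omega> = (\<Sum>l<m 0. Z 0 $$ (i, l) * \<alpha> 0 l \<omega>)"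
  proof -
    have "(\<Sum>l<N. 1\<^sub>m N $$ (i, l) * \<alpha> 0 l \<omega>) = (\<Sum>l<N. if l = i then \<alpha> 0 l \<omega> else 0)"
      using i by (intro sum.cong) auto
    then show ?thesis
      using i by (simp add: assms(3,4))
  qed
  also have "(\<Sum>t=1..s. \<Sum>l<m t. Z t $$ (i, l) * \<alpha> t l \<omega>) + (\<Sum>l<m 0. Z 0 $$ (i, l) * \<alpha> 0 l \<omega>) =
      (\<Sum>t\<le>s. \<Sum>l<m t. Z t $$ (i, l) * \<alpha> t l \<omega>)"
    by (simp add: atMost_atLeast0 sum.atLeast_Suc_atMost)
  also have "\<dots> = (\<Sum>a\<in>(SIGMA t:{..s}. {..<m t}). (case a of (t, l) \<Rightarrow> Z t $$ (i, l)) * (case a of (t, l) \<Rightarrow> \<alpha> t l) \<omega>)"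
    by (subst sum.Sigma) (auto intro!: sum.cong)
  finally show ?thesis .
qed

lemma Gam_eq:
  assumes "\<forall>t\<le>s. Z t \<in> carrier_mat N (m t)" "i < N" "j < N"
  shows "Gam s Z \<gamma> i j = (\<Sum>t\<le>s. \<gamma> t * (\<Sum>l<m t. Z t $$ (i, l) * Z t $$ (j, l)))"
  unfolding Gam_def
proof (intro sum.cong refl)
  fix t assume "t \<in> {..s}"
  then have "Z t \<in> carrier_mat N (m t)"
    using assms(1) by simp
  then show "\<gamma> t * (row (Z t) i \<bullet> row (Z t) j) = \<gamma> t * (\<Sum>l<m t. Z t $$ (i, l) * Z t $$ (j, l))"
    using assms by (auto simp: scalar_prod_def lessThan_atLeast0)
qed

text \<open>The identity in V is the term t = 0 of \<Gamma>, where \<gamma>_0 = 1. The coordinate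
  \<theta>_0 is \<lambda> and not \<gamma>_0, so that term is split off before the two sums are
  compared.\<close>

lemma var_mat_entry:
  assumes Z: "\<forall>t\<le>s. Z t \<in> carrier_mat N (m t)" "Z 0 = 1\<^sub>m N" and ij: "i < N" "j < N"
    and \<theta>: "\<theta> = (\<lambda>t. if t = 0 then lam else \<gamma> t)" "\<gamma> 0 = 1"
  shows "var_mat N s Z \<theta> $$ (i, j) = lam * Gam s Z \<gamma> i j"
proof -
  have entry: "(Z t * (Z t)\<^sup>T) $$ (i, j) = row (Z t) i \<bullet> row (Z t) j" if "t \<le> s" for t
    using Z(1) that ij by auto
  have "Gam s Z \<gamma> i j = row (Z 0) i \<bullet> row (Z 0) j + (\<Sum>t=1..s. \<gamma> t * (row (Z t) i \<bullet> row (Z t) j))"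
    by (simp add: Gam_def atMost_atLeast0 sum.atLeast_Suc_atMost \<theta>(2))
  also have "(\<Sum>t=1..s. \<gamma> t * (row (Z t) i \<bullet> row (Z t) j)) = (\<Sum>t=1..s. \<theta> t * (Z t * (Z t)\<^sup>T) $$ (i, j))"
    by (intro sum.cong refl) (simp add: entry \<theta>(1) del: index_mult_mat)
  also have "row (Z 0) i \<bullet> row (Z 0) j = (1\<^sub>m N * (1\<^sub>m N)\<^sup>T) $$ (i, j)"
    using entry[of 0] by (simp add: Z(2) del: index_mult_mat)
  finally show ?thesis
    using ij by (simp add: var_mat_def \<theta>(1))
qed

section \<open>The two formulas for the covariance of the scores\<close>

theorem theorem1:
  fixes M :: "'a measure"
    and N p s :: nat and m :: "nat \<Rightarrow> nat"
    and X T :: "real mat" and Z B :: "nat \<Rightarrow> real mat" and V :: "real mat"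
    and \<beta> :: "real vec" and y u :: "'a \<Rightarrow> real vec"
    and \<alpha> :: "nat \<Rightarrow> nat \<Rightarrow> 'a \<Rightarrow> real"
    and \<sigma> \<theta> \<gamma> \<kappa> :: "nat \<Rightarrow> real" and lam c0 :: real
    and score :: "nat \<Rightarrow> 'a \<Rightarrow> real"
    and f :: "nat \<times> nat \<times> nat \<times> nat \<Rightarrow> ((nat \<Rightarrow> real) \<Rightarrow> real)"
    and c :: "nat \<Rightarrow> nat \<Rightarrow> nat \<times> nat \<times> nat \<times> nat \<Rightarrow> real"
    and j k :: nat
  assumes "prob_space M"
    and "\<And>t. t \<le> s \<Longrightarrow> 0 < m t" and "m 0 = N"
    and "X \<in> carrier_mat N p" and "vec_space.rank N X = p"
    and "\<And>t. t \<le> s \<Longrightarrow> Z t \<in> carrier_mat N (m t)" and "Z 0 = 1\<^sub>m N"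
    and "\<beta> \<in> carrier_vec p"
    and "prob_space.indep_vars M (\<lambda>t. PiM {..<m t} (\<lambda>_. borel))
           (\<lambda>t \<omega>. \<lambda>l\<in>{..<m t}. \<alpha> t l \<omega>) {..s}"
    and "\<And>t. t \<le> s \<Longrightarrow> prob_space.indep_vars M (\<lambda>_. borel) (\<alpha> t) {..<m t}"
    and "\<And>t l l'. t \<le> s \<Longrightarrow> l < m t \<Longrightarrow> l' < m t \<Longrightarrow>
           distr M borel (\<alpha> t l) = distr M borel (\<alpha> t l')"
    and "\<And>t l. t \<le> s \<Longrightarrow> l < m t \<Longrightarrow> integrable M (\<lambda>\<omega>. \<alpha> t l \<omega> ^ 4)"
    and "\<And>t l. t \<le> s \<Longrightarrow> l < m t \<Longrightarrow> prob_space.expectation M (\<alpha> t l) = 0"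
    and "\<And>t l. t \<le> s \<Longrightarrow> l < m t \<Longrightarrow> prob_space.variance M (\<alpha> t l) = \<sigma> t ^ 2"
    and "\<sigma> 0 ^ 2 > 0"
    and "lam = \<sigma> 0 ^ 2" and "\<gamma> = (\<lambda>t. \<sigma> t ^ 2 / \<sigma> 0 ^ 2)"
    and "\<theta> = (\<lambda>t. if t = 0 then lam else \<gamma> t)"
    and "\<kappa> = kurtosis M \<alpha> \<sigma>"
    and "y = response N s m X Z \<beta> \<alpha>" and "u = (\<lambda>\<omega>. y \<omega> - X *\<^sub>v \<beta>)"
    and "V = var_mat N s Z \<theta>" and "B = B_mat N s X Z \<theta>"
    and "T \<in> carrier_mat N (N - p)" and "vec_space.rank N T = N - p"
    and "T\<^sup>T * X = 0\<^sub>m (N - p) p"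
    and "score = (\<lambda>j \<omega>. partial_deriv j (restricted_loglik c0 T N s X Z (y \<omega>)) \<theta>)"
    and "f = f_fun s m Z" and "c = (\<lambda>j k. c_coef N f (B j) (B k))"
    and "j \<le> s" and "k \<le> s"
  shows "covariance M (score j) (score k) =
      2 * mat_trace (B j * V * B k * V) +
      (\<Sum>t\<le>s. \<kappa> t * (\<Sum>l<m t. (col (Z t) l \<bullet> (B j *\<^sub>v col (Z t) l)) *
                              (col (Z t) l \<bullet> (B k *\<^sub>v col (Z t) l)))) \<and>
    covariance M (score j) (score k) =
      prob_space.expectation M (\<lambda>\<omega>.
        \<Sum>(i1, i2, i3, i4) \<in> {i \<in> quads N. f i \<noteq> (\<lambda>_. 0)}.
          c j k (i1, i2, i3, i4) * (u \<omega> $ i1 * u \<omega> $ i2 * u \<omega> $ i3 * u \<omega> $ i4)) +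
      (2 * mat_trace (B j * V * B k * V) -
       3 * lam ^ 2 * (\<Sum>(i1, i2, i3, i4) \<in> {i \<in> quads N. f i \<noteq> (\<lambda>_. 0)}.
          c j k (i1, i2, i3, i4) * Gam s Z \<gamma> i1 i3 * Gam s Z \<gamma> i2 i4))"
proof -
  interpret prob_space M
    by fact
  note lam = \<open>lam = \<sigma> 0 ^ 2\<close> and \<gamma> = \<open>\<gamma> = (\<lambda>t. \<sigma> t ^ 2 / \<sigma> 0 ^ 2)\<close>
    and \<theta> = \<open>\<theta> = (\<lambda>t. if t = 0 then lam else \<gamma> t)\<close> and V = \<open>V = var_mat N s Z \<theta>\<close>
    and B = \<open>B = B_mat N s X Z \<theta>\<close> and f = \<open>f = f_fun s m Z\<close>
    and X = \<open>X \<in> carrier_mat N p\<close> \<open>vec_space.rank N X = p\<close>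
    and T = \<open>T \<in> carrier_mat N (N - p)\<close> \<open>vec_space.rank N T = N - p\<close>
    and \<beta> = \<open>\<beta> \<in> carrier_vec p\<close>
  have Z: "\<forall>t\<le>s. Z t \<in> carrier_mat N (m t)"
    using assms(6) by blast
  have lam_pos: "lam > 0"
    using \<open>\<sigma> 0 ^ 2 > 0\<close> by (simp add: lam)
  have \<gamma>0: "\<gamma> 0 = 1"
    using \<open>\<sigma> 0 ^ 2 > 0\<close> by (simp add: \<gamma>)
  have \<theta>_nonneg: "\<forall>t\<le>s. \<theta> t \<ge> 0" and \<theta>0: "\<theta> 0 > 0"
    using lam_pos by (auto simp: \<theta> \<gamma>)
  have reg: "gls_regular N p X (var_mat N s Z \<theta>)"
    by (rule var_mat_gls_regular[OF Z \<theta>0 \<theta>_nonneg X])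
  have Bc: "B i \<in> carrier_mat N N" and Bt: "(B i)\<^sup>T = B i" and BX: "B i * X = 0\<^sub>m N p" if "i \<le> s" for i
    using B_mat_props[OF Z that reg] by (simp_all add: B)
  have Vc: "V \<in> carrier_mat N N" and Vt: "V\<^sup>T = V"
    by (simp_all add: V var_mat_carrier var_mat_transpose[OF Z])

  \<comment> \<open>All components of the random effects and errors become one family \<xi> over
    pairs (t, l), and z i is row i of the concatenated matrix (Z_0, ..., Z_s).\<close>
  define K where "K = (SIGMA t:{..s}. {..<m t})"
  define \<xi> where "\<xi> = (\<lambda>(t, l). \<alpha> t l)"
  define z where "z i = (\<lambda>(t, l). Z t $$ (i, l))" for i
  define U where "U i \<omega> = (\<Sum>a\<in>K. z i a * \<xi> a \<omega>)" for i \<omega>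
  define v where "v a = expectation (\<lambda>\<omega>. \<xi> a \<omega> ^ 2)" for a
  define \<kappa>' where "\<kappa>' a = expectation (\<lambda>\<omega>. \<xi> a \<omega> ^ 4) - 3 * (v a)\<^sup>2" for a
  have fam: "moment_family M K \<xi>"
    unfolding K_def \<xi>_def by (rule moment_family_blocks) (fact assms)+

  have u_U: "u \<omega> $ i = U i \<omega>" if "i < N" for i \<omega>
    unfolding \<open>u = _\<close> \<open>y = _\<close> U_def K_def z_def \<xi>_def
    by (rule response_minus_fixed_part[OF X(1) \<beta> \<open>Z 0 = _\<close> \<open>m 0 = N\<close> Z that])
  have yc: "y \<omega> \<in> carrier_vec N" for \<omega>
    by (simp add: \<open>y = _\<close> response_def)
  have uc: "u \<omega> \<in> carrier_vec N" for \<omega>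
    using X \<beta> yc[of \<omega>] by (auto simp: \<open>u = _\<close>)

  have v_eq: "v (t, l) = \<sigma> t ^ 2" if "t \<le> s" "l < m t" for t l
    using assms(14)[OF that] by (simp add: v_def \<xi>_def assms(13)[OF that])
  \<comment> \<open>\<open>kurtosis\<close> looks at component 0 only; identical distribution within
    the block carries its fourth moment over to component l.\<close>
  have \<kappa>'_eq: "\<kappa>' (t, l) = \<kappa> t" if "t \<le> s" "l < m t" for t l
  proof -
    have meas: "\<alpha> t l' \<in> borel_measurable M" if "l' < m t" for l'
      using assms(10)[OF \<open>t \<le> s\<close>] that by (auto simp: indep_vars_def)
    have E: "expectation (\<lambda>\<omega>. \<alpha> t l' \<omega> ^ 4) = integral\<^sup>L (distr M borel (\<alpha> t l')) (\<lambda>x. x ^ 4)" if "l' < m t" for l'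
      by (rule integral_distr[symmetric]) (use meas[OF that] in auto)
    have "0 < m t"
      using that by simp
    then have "expectation (\<lambda>\<omega>. \<alpha> t l \<omega> ^ 4) = expectation (\<lambda>\<omega>. \<alpha> t 0 \<omega> ^ 4)"
      using E that assms(11)[OF \<open>t \<le> s\<close> \<open>l < m t\<close> \<open>0 < m t\<close>] by simp
    then show ?thesis
      by (simp add: \<kappa>'_def v_eq[OF that] \<open>\<kappa> = _\<close> kurtosis_def \<xi>_def power_mult[symmetric])
  qed

  have K_sum: "(\<Sum>a\<in>K. h a) = (\<Sum>t\<le>s. \<Sum>l<m t. h (t, l))" for h :: "nat \<times> nat \<Rightarrow> real"
    unfolding K_def by (subst sum.Sigma) auto
  have G: "(\<Sum>a\<in>K. z i a * z j a * v a) = lam * Gam s Z \<gamma> i j" if "i < N" "j < N" for i j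
  proof -
    have "(\<Sum>a\<in>K. z i a * z j a * v a) = (\<Sum>t\<le>s. \<Sum>l<m t. lam * (\<gamma> t * (Z t $$ (i, l) * Z t $$ (j, l))))"
      unfolding K_sum
    proof (intro sum.cong refl)
      fix t l assume "t \<in> {..s}" "l \<in> {..<m t}"
      \<comment> \<open>This includes t = 0, because \<gamma> is \<sigma>_t^2 / \<sigma>_0^2 for
        every t.\<close>
      moreover have "\<sigma> t ^ 2 = lam * \<gamma> t"
        using lam_pos by (simp add: \<gamma> lam)
      ultimately show "z i (t, l) * z j (t, l) * v (t, l) = lam * (\<gamma> t * (Z t $$ (i, l) * Z t $$ (j, l)))"
        by (simp add: v_eq z_def)
    qed
    then show ?thesis
      unfolding Gam_eq[OF Z that] by (simp add: sum_distrib_left)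
  qed
  have G_V: "lam * Gam s Z \<gamma> i j = V $$ (i, j)" if "i < N" "j < N" for i j
    unfolding V by (rule var_mat_entry[OF Z \<open>Z 0 = _\<close> that \<theta> \<gamma>0, symmetric])
  have F: "(\<Sum>a\<in>K. z i1 a * z i2 a * z i3 a * z i4 a * \<kappa>' a) = f (i1, i2, i3, i4) \<kappa>" for i1 i2 i3 i4
    unfolding K_sum f f_fun_def prod.case sum_distrib_left
    by (intro sum.cong refl) (simp add: \<kappa>'_eq z_def)

  have score: "\<exists>C. score i = (\<lambda>\<omega>. C + (\<Sum>i1<N. \<Sum>i2<N. B i $$ (i1, i2) * (U i1 \<omega> * U i2 \<omega>)))" if i: "i \<le> s" for i
  proof -
    obtain C where C: "\<And>y. y \<in> carrier_vec N \<Longrightarrow>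
        partial_deriv i (restricted_loglik c0 T N s X Z y) \<theta> = C + y \<bullet> (B i *\<^sub>v y)"
      using restricted_loglik_partial_deriv[OF Z i \<theta>0 \<theta>_nonneg X T] unfolding B by blast
    have "score i \<omega> = C + (\<Sum>i1<N. \<Sum>i2<N. B i $$ (i1, i2) * (U i1 \<omega> * U i2 \<omega>))" for \<omega>
    proof -
      have "score i \<omega> = C + y \<omega> \<bullet> (B i *\<^sub>v y \<omega>)"
        by (simp only: \<open>score = _\<close> C[OF yc])
      also have "y \<omega> \<bullet> (B i *\<^sub>v y \<omega>) = u \<omega> \<bullet> (B i *\<^sub>v u \<omega>)"
        unfolding \<open>u = _\<close> by (rule quad_form_shift[OF Bc Bt BX X(1) \<beta> yc]) (rule i)+
      also have "\<dots> = (\<Sum>i1<N. \<Sum>i2<N. B i $$ (i1, i2) * (u \<omega> $ i1 * u \<omega> $ i2))"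
        by (rule quad_form_sum[OF Bc[OF i] uc])
      also have "\<dots> = (\<Sum>i1<N. \<Sum>i2<N. B i $$ (i1, i2) * (U i1 \<omega> * U i2 \<omega>))"
        by (intro sum.cong refl) (simp add: u_U)
      finally show ?thesis .
    qed
    then show ?thesis
      by blast
  qed
  obtain C1 C2 where
    C1: "score j = (\<lambda>\<omega>. C1 + (\<Sum>i1<N. \<Sum>i2<N. B j $$ (i1, i2) * (U i1 \<omega> * U i2 \<omega>)))" and
    C2: "score k = (\<lambda>\<omega>. C2 + (\<Sum>i1<N. \<Sum>i2<N. B k $$ (i1, i2) * (U i1 \<omega> * U i2 \<omega>)))"
    using score[OF \<open>j \<le> s\<close>] score[OF \<open>k \<le> s\<close>] by blast
  note Bj = Bc[OF \<open>j \<le> s\<close>] and Bk = Bc[OF \<open>k \<le> s\<close>]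
  have "covariance M (score j) (score k) =
      (\<Sum>i1<N. \<Sum>i2<N. \<Sum>i3<N. \<Sum>i4<N. B j $$ (i1, i2) * B k $$ (i3, i4) *
        ((\<Sum>a\<in>K. z i1 a * z i3 a * v a) * (\<Sum>a\<in>K. z i2 a * z i4 a * v a) +
         (\<Sum>a\<in>K. z i1 a * z i4 a * v a) * (\<Sum>a\<in>K. z i2 a * z i3 a * v a) +
         (\<Sum>a\<in>K. z i1 a * z i2 a * z i3 a * z i4 a * \<kappa>' a)))"
    unfolding C1 C2 U_def v_def \<kappa>'_def by (rule covariance_quad_forms[OF fam])
  also have "\<dots> = (\<Sum>i1<N. \<Sum>i2<N. \<Sum>i3<N. \<Sum>i4<N. B j $$ (i1, i2) * B k $$ (i3, i4) *
        (V $$ (i1, i3) * V $$ (i2, i4) + V $$ (i1, i4) * V $$ (i2, i3)) +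
        B j $$ (i1, i2) * B k $$ (i3, i4) * f (i1, i2, i3, i4) \<kappa>)"
    by (intro sum.cong refl) (simp add: G G_V F distrib_left)
  also have "\<dots> = 2 * mat_trace (B j * V * B k * V) +
      (\<Sum>i1<N. \<Sum>i2<N. \<Sum>i3<N. \<Sum>i4<N. B j $$ (i1, i2) * B k $$ (i3, i4) * f (i1, i2, i3, i4) \<kappa>)"
    using quad_sum_symmetric[OF Bj Vc Bk Bt[OF \<open>k \<le> s\<close>] Vt] by (simp only: sum.distrib)
  finally have cov: "covariance M (score j) (score k) = 2 * mat_trace (B j * V * B k * V) +
      (\<Sum>i1<N. \<Sum>i2<N. \<Sum>i3<N. \<Sum>i4<N. B j $$ (i1, i2) * B k $$ (i3, i4) * f (i1, i2, i3, i4) \<kappa>)" .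

  define S where "S = {i \<in> quads N. f i \<noteq> (\<lambda>_. 0)}"
  have S: "finite S"
    using finite_quads by (simp add: S_def)
  have c: "c j k q = c_val N f (B j) (B k) (f q)" for q
    by (simp add: \<open>c = _\<close> c_coef_def)
  have lt: "i1 < N \<and> i2 < N \<and> i3 < N \<and> i4 < N" if "(i1, i2, i3, i4) \<in> S" for i1 i2 i3 i4
    using that by (auto simp: S_def quads_def)

  have "(\<Sum>i1<N. \<Sum>i2<N. \<Sum>i3<N. \<Sum>i4<N. B j $$ (i1, i2) * B k $$ (i3, i4) * f (i1, i2, i3, i4) \<kappa>) =
      (\<Sum>q\<in>quads N. (case q of (i1, i2, i3, i4) \<Rightarrow> B j $$ (i1, i2) * B k $$ (i3, i4)) * f q \<kappa>)"
    by (simp add: sum_quads)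
  \<comment> \<open>A quadruple outside S has f = 0 as a function, hence also at the actual
    \<kappa>. Quadruples in S whose f happens to vanish at this \<kappa> do no harm.\<close>
  also have "\<dots> = (\<Sum>q\<in>S. (case q of (i1, i2, i3, i4) \<Rightarrow> B j $$ (i1, i2) * B k $$ (i3, i4)) * f q \<kappa>)"
    by (intro sum.mono_neutral_right) (auto simp: S_def finite_quads)
  also have "\<dots> = (\<Sum>q\<in>S. c j k q * f q \<kappa>)"
    unfolding S_def c by (rule sum_c_val[where P = "\<lambda>g. g \<noteq> (\<lambda>_. 0)" and h = "\<lambda>g. g \<kappa>", symmetric])
  finally have average: "(\<Sum>i1<N. \<Sum>i2<N. \<Sum>i3<N. \<Sum>i4<N.
      B j $$ (i1, i2) * B k $$ (i3, i4) * f (i1, i2, i3, i4) \<kappa>) = (\<Sum>q\<in>S. c j k q * f q \<kappa>)" .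

  \<comment> \<open>H holds the covariances of the components of u, and W is the contribution of the
    pairing (13)(24), the one displayed in the claim.\<close>
  define H where "H i1 i2 = lam * Gam s Z \<gamma> i1 i2" for i1 i2
  define W where "W = (\<Sum>(i1, i2, i3, i4)\<in>S. c j k (i1, i2, i3, i4) * (H i1 i3 * H i2 i4))"
  have u4: "(\<lambda>\<omega>. c j k (i1, i2, i3, i4) * (u \<omega> $ i1 * u \<omega> $ i2 * u \<omega> $ i3 * u \<omega> $ i4)) =
      (\<lambda>\<omega>. c j k (i1, i2, i3, i4) * (U i1 \<omega> * U i2 \<omega> * U i3 \<omega> * U i4 \<omega>))"
    if "(i1, i2, i3, i4) \<in> S" for i1 i2 i3 i4
    using lt[OF that] by (simp add: u_U)
  have U4: "integrable M (\<lambda>\<omega>. U i1 \<omega> * U i2 \<omega> * U i3 \<omega> * U i4 \<omega>)" for i1 i2 i3 i4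
    unfolding U_def by (rule linear_forms_fourth[OF fam])
  have EU4: "expectation (\<lambda>\<omega>. U i1 \<omega> * U i2 \<omega> * U i3 \<omega> * U i4 \<omega>) =
      H i1 i2 * H i3 i4 + H i1 i3 * H i2 i4 + H i1 i4 * H i2 i3 + f (i1, i2, i3, i4) \<kappa>"
    if "(i1, i2, i3, i4) \<in> S" for i1 i2 i3 i4
  proof -
    have "expectation (\<lambda>\<omega>. U i1 \<omega> * U i2 \<omega> * U i3 \<omega> * U i4 \<omega>) =
        (\<Sum>a\<in>K. z i1 a * z i2 a * v a) * (\<Sum>a\<in>K. z i3 a * z i4 a * v a) +
        (\<Sum>a\<in>K. z i1 a * z i3 a * v a) * (\<Sum>a\<in>K. z i2 a * z i4 a * v a) +
        (\<Sum>a\<in>K. z i1 a * z i4 a * v a) * (\<Sum>a\<in>K. z i2 a * z i3 a * v a) +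
        (\<Sum>a\<in>K. z i1 a * z i2 a * z i3 a * z i4 a * \<kappa>' a)"
      unfolding U_def v_def \<kappa>'_def by (rule linear_forms_fourth[OF fam])
    then show ?thesis
      using lt[OF that] by (simp add: G F H_def)
  qed
  have "expectation (\<lambda>\<omega>. \<Sum>(i1, i2, i3, i4)\<in>S.
        c j k (i1, i2, i3, i4) * (u \<omega> $ i1 * u \<omega> $ i2 * u \<omega> $ i3 * u \<omega> $ i4)) =
      (\<Sum>q\<in>S. expectation (\<lambda>\<omega>. case q of (i1, i2, i3, i4) \<Rightarrow>
        c j k (i1, i2, i3, i4) * (u \<omega> $ i1 * u \<omega> $ i2 * u \<omega> $ i3 * u \<omega> $ i4)))"
  proof (rule Bochner_Integration.integral_sum)
    fix q assume "q \<in> S"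
    then show "integrable M (\<lambda>\<omega>. case q of (i1, i2, i3, i4) \<Rightarrow>
        c j k (i1, i2, i3, i4) * (u \<omega> $ i1 * u \<omega> $ i2 * u \<omega> $ i3 * u \<omega> $ i4))"
      by (cases q) (simp add: u4 U4)
  qed
  also have "\<dots> = (\<Sum>(i1, i2, i3, i4)\<in>S. c j k (i1, i2, i3, i4) * (H i1 i2 * H i3 i4) +
      c j k (i1, i2, i3, i4) * (H i1 i3 * H i2 i4) + c j k (i1, i2, i3, i4) * (H i1 i4 * H i2 i3) +
      c j k (i1, i2, i3, i4) * f (i1, i2, i3, i4) \<kappa>)"
  proof (intro sum.cong refl)
    fix q assume "q \<in> S"
    then show "expectation (\<lambda>\<omega>. case q of (i1, i2, i3, i4) \<Rightarrow>
        c j k (i1, i2, i3, i4) * (u \<omega> $ i1 * u \<omega> $ i2 * u \<omega> $ i3 * u \<omega> $ i4)) =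
      (case q of (i1, i2, i3, i4) \<Rightarrow> c j k (i1, i2, i3, i4) * (H i1 i2 * H i3 i4) +
      c j k (i1, i2, i3, i4) * (H i1 i3 * H i2 i4) + c j k (i1, i2, i3, i4) * (H i1 i4 * H i2 i3) +
      c j k (i1, i2, i3, i4) * f (i1, i2, i3, i4) \<kappa>)"
      by (cases q) (simp add: u4 EU4 distrib_left)
  qed
  also have "\<dots> = (\<Sum>(i1, i2, i3, i4)\<in>S. c j k (i1, i2, i3, i4) * (H i1 i2 * H i3 i4)) + W +
      (\<Sum>(i1, i2, i3, i4)\<in>S. c j k (i1, i2, i3, i4) * (H i1 i4 * H i2 i3)) + (\<Sum>q\<in>S. c j k q * f q \<kappa>)"
    by (simp only: W_def split_def sum.distrib prod.collapse)
  \<comment> \<open>Here c is used in the form \<open>c_val\<close> applied to f, a weight depending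
    on the value of f alone, so indices may be exchanged.\<close>
  also have "(\<Sum>(i1, i2, i3, i4)\<in>S. c j k (i1, i2, i3, i4) * (H i1 i2 * H i3 i4)) = W"
    unfolding W_def S_def c f by (rule sum_f_fun_swap(1)[where P = "\<lambda>g. g \<noteq> (\<lambda>_. 0)"])
  also have "(\<Sum>(i1, i2, i3, i4)\<in>S. c j k (i1, i2, i3, i4) * (H i1 i4 * H i2 i3)) = W"
    unfolding W_def S_def c f by (rule sum_f_fun_swap(2)[where P = "\<lambda>g. g \<noteq> (\<lambda>_. 0)"])
  finally have E: "expectation (\<lambda>\<omega>. \<Sum>(i1, i2, i3, i4)\<in>S.
        c j k (i1, i2, i3, i4) * (u \<omega> $ i1 * u \<omega> $ i2 * u \<omega> $ i3 * u \<omega> $ i4)) =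
      3 * W + (\<Sum>q\<in>S. c j k q * f q \<kappa>)"
    by simp
  have W: "W = lam ^ 2 * (\<Sum>(i1, i2, i3, i4)\<in>S. c j k (i1, i2, i3, i4) * Gam s Z \<gamma> i1 i3 * Gam s Z \<gamma> i2 i4)"
    unfolding W_def H_def sum_distrib_left by (intro sum.cong refl) (auto simp: power2_eq_square)
  \<comment> \<open>The subtracted term is 3 W. Removing it from the expectation leaves the sum of c
    times f over S, which by averaging is the kurtosis term of the first formula.\<close>
  show ?thesis
    unfolding S_def[symmetric]
    using cov average E W sum_f_fun[OF Z Bj Bk, of \<kappa>] by (simp add: f)
qed

end
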